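(* Let $\Gamma=(G,\sigma)$ be a signed graph with potential $\kappa=0$. If $\mathfrak S(f)=k$ for some eigenfunction $f$ of $\Delta_1^\sigma$ corresponding to $\lambda_1(\Delta_1^\sigma)$, or to $\lambda_2(\Delta_1^\sigma)$, or to the smallest positive eigenvalue of $\Delta_1^\sigma$, then $\lambda_i(\Delta_1^\sigma)=h_i^\sigma$ for $i=1,\dots,k$.
   Context: Setting. $G=(V,E)$ is a finite simple undirected graph, $n=|V|$, with edge measure $w:E\to(0,\infty)$, vertex weight $\mu:V\to(0,\infty)$ and signature $\sigma:E\to\{-1,1\}$ (potential $\kappa=0$); values are written $w_{xy},\sigma_{xy},\mu_x$, and $x\sim y$ means $\{x,y\}\in E$. Eigenpairs. Let $\mathrm{Sgn}(t)=\{1\}$ if $t>0$, $[-1,1]$ if $t=0$, $\{-1\}$ if $t<0$. A nonzero $f:V\to\mathbb R$ is an eigenfunction of $\Delta_1^\sigma$ with eigenvalue $\lambda$ if there are numbers $z_{xy}\in\mathrm{Sgn}(f(x)-\sigma_{xy}f(y))$ (for all ordered pairs $x\sim y$) with $z_{xy}=-\sigma_{xy}z_{yx}$, and $z_x'\in\mathrm{Sgn}(f(x))$, such that $\sum_{y\sim x}w_{xy}z_{xy}=\lambda\mu_xz'_x$ for all $x\in V$. Variational eigenvalues. $\mathcal S_1=\{f\in\mathbb R^V:\sum_x\mu_x|f(x)|=1\}$. For a compact set $S=-S$ its index (Krasnoselskii genus) $\gamma(S)$ is $0$ if $S=\emptyset$, otherwise the least positive integer $k$ for which an odd continuous map $S\to\mathbb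 R^k\setminus\{0\}$ exists ($\infty$ if none). $\mathcal F_k(\mathcal S_1)$ is the family of compact $A=-A\subset\mathcal S_1$ with $\gamma(A)\ge k$. With $\mathcal R_1^\sigma(f)=\frac{\sum_{\{x,y\}\in E}w_{xy}|f(x)-\sigma_{xy}f(y)|}{\sum_{x\in V}\mu_x|f(x)|}$, set $\lambda_k(\Delta_1^\sigma)=\inf_{S\in\mathcal F_k(\mathcal S_1)}\sup_{f\in S}\mathcal R_1^\sigma(f)$, $k=1,\dots,n$. Strong nodal domains. A sequence $x_1,\dots,x_m$ of vertices is a strong nodal domain walk of $f$ if $x_i\sim x_{i+1}$ and $f(x_i)\sigma_{x_ix_{i+1}}f(x_{i+1})>0$ for all $i<m$. $\mathfrak S(f)$ is the number of classes of the equivalence relation on $\{x:f(x)\ne0\}$: $x=y$ or a strong nodal domain walk connects $x$ and $y$. Signed Cheeger constants. For $V_1,V_2\subset V$: $|E^{\pm}(V_1,V_2)|=\sum_{x\in V_1}\sum_{y\in V_2,\,y\sim x,\,\sigma_{xy}=\pm1}w_{xy}$, $|E^\pm(V_1)|=|E^\pm(V_1,V_1)|$, $|\partial V_1|=\sum_{x\in V_1}\sum_{y\notin V_1,\,y\sim x}w_{xy}$, $\mathrm{vol}_\mu(V_1)=\sum_{x\in V_1}\mu_x$. For disjoint $V_1,V_2$ with nonempty union, $\beta^\sigma(V_1,V_2)=\frac{2|E^+(V_1,V_2)|+|E^-(V_1)|+|E^-(V_2)|+|\partial(V_1\cup V_2)|}{\mathrm{vol}_\mu(V_1\cup V_2)}$.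 Then $h_k^\sigma=\min\max_{i=1,\dots,k}\beta^\sigma(V_{2i-1},V_{2i})$, the minimum over all families $\{(V_{2i-1},V_{2i})\}_{i=1}^k$ with $V_{2i-1}\cap V_{2i}=\emptyset$, $V_{2i-1}\cup V_{2i}\neq\emptyset$, and $(V_{2i-1}\cup V_{2i})\cap(V_{2j-1}\cup V_{2j})=\emptyset$ for $i\ne j$ ($1\le k\le n$). *)

theory Defs
  imports "HOL-Analysis.Analysis"
begin

text \<open>The vertex set is the finite type \<open>'v\<close>, so that functions on the vertices are the
  vectors in \<open>real ^ 'v\<close>. Edges are two-element sets; weight and signature are functions of the
  (unordered) edge, and only their values on edges matter.\<close>

record 'v sgraph =
  edges :: "'v set set"
  edge_weight :: "'v set \<Rightarrow> real"
  vertex_weight :: "'v \<Rightarrow> real"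
  signature :: "'v set \<Rightarrow> real"

definition signed_graph :: "'v::finite sgraph \<Rightarrow> bool" where
  "signed_graph \<Gamma> \<longleftrightarrow>
     (\<forall>e\<in>edges \<Gamma>. card e = 2 \<and> edge_weight \<Gamma> e > 0 \<and> signature \<Gamma> e \<in> {-1, 1}) \<and>
     (\<forall>x. vertex_weight \<Gamma> x > 0)"

definition adj :: "'v::finite sgraph \<Rightarrow> 'v \<Rightarrow> 'v \<Rightarrow> bool" where
  "adj \<Gamma> x y \<longleftrightarrow> {x, y} \<in> edges \<Gamma>"

definition wt :: "'v::finite sgraph \<Rightarrow> 'v \<Rightarrow> 'v \<Rightarrow> real" where
  "wt \<Gamma> x y = edge_weight \<Gamma> {x, y}"

definition sg :: "'v::finite sgraph \<Rightarrow> 'v \<Rightarrow> 'v \<Rightarrow> real" where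
  "sg \<Gamma> x y = signature \<Gamma> {x, y}"

definition Sgn :: "real \<Rightarrow> real set" where
  "Sgn t = (if t > 0 then {1} else if t = 0 then {-1..1} else {-1})"

definition eigenpair :: "'v::finite sgraph \<Rightarrow> real ^ 'v \<Rightarrow> real \<Rightarrow> bool" where
  "eigenpair \<Gamma> f l \<longleftrightarrow> f \<noteq> 0 \<and>
     (\<exists>z z'. (\<forall>x y. adj \<Gamma> x y \<longrightarrow>
                 z x y \<in> Sgn (f $ x - sg \<Gamma> x y * f $ y) \<and> z x y = - sg \<Gamma> x y * z y x) \<and>
             (\<forall>x. z' x \<in> Sgn (f $ x)) \<and>
             (\<forall>x. (\<Sum>y | adj \<Gamma> x y. wt \<Gamma> x y * z x y) = l * vertex_weight \<Gamma> x * z' x))"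

definition eigenvalue :: "'v::finite sgraph \<Rightarrow> real \<Rightarrow> bool" where
  "eigenvalue \<Gamma> l \<longleftrightarrow> (\<exists>f. eigenpair \<Gamma> f l)"

definition smallest_positive_eigenvalue :: "'v::finite sgraph \<Rightarrow> real \<Rightarrow> bool" where
  "smallest_positive_eigenvalue \<Gamma> l \<longleftrightarrow>
     eigenvalue \<Gamma> l \<and> l > 0 \<and> (\<forall>l'. eigenvalue \<Gamma> l' \<and> l' > 0 \<longrightarrow> l \<le> l')"

text \<open>\<open>Euclidean_space k\<close> is the space of real sequences vanishing from index \<open>k\<close> on, i.e. the
  \<open>k\<close>-dimensional Euclidean space. The infimum of the empty set in \<^typ>\<open>enat\<close> is infinity.\<close>

definition odd_map_to_punctured :: "(real ^ 'v::finite) set \<Rightarrow> nat \<Rightarrow> bool" where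
  "odd_map_to_punctured S k \<longleftrightarrow>
     (\<exists>\<phi>. continuous_map (top_of_set S) (subtopology (Euclidean_space k) (- {\<lambda>_. 0})) \<phi> \<and>
          (\<forall>x\<in>S. \<forall>i. \<phi> (- x) i = - \<phi> x i))"

definition genus :: "(real ^ 'v::finite) set \<Rightarrow> enat" where
  "genus S = (if S = {} then 0 else Inf {enat k | k. k > 0 \<and> odd_map_to_punctured S k})"

definition unit_sphere1 :: "'v::finite sgraph \<Rightarrow> (real ^ 'v) set" where
  "unit_sphere1 \<Gamma> = {f. (\<Sum>x\<in>UNIV. vertex_weight \<Gamma> x * \<bar>f $ x\<bar>) = 1}"

definition genus_family :: "'v::finite sgraph \<Rightarrow> nat \<Rightarrow> (real ^ 'v) set set" where
  "genus_family \<Gamma> k =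
     {A. compact A \<and> uminus ` A = A \<and> A \<subseteq> unit_sphere1 \<Gamma> \<and> genus A \<ge> enat k}"

text \<open>The factor \<open>1/2\<close> turns the sum over ordered adjacent pairs into the sum over edges: the
  summand is symmetric in \<open>x\<close> and \<open>y\<close> because the signature takes values \<open>1\<close> and \<open>-1\<close>.\<close>

definition rayleigh1 :: "'v::finite sgraph \<Rightarrow> real ^ 'v \<Rightarrow> real" where
  "rayleigh1 \<Gamma> f =
     (1/2 * (\<Sum>x\<in>UNIV. \<Sum>y | adj \<Gamma> x y. wt \<Gamma> x y * \<bar>f $ x - sg \<Gamma> x y * f $ y\<bar>))
     / (\<Sum>x\<in>UNIV. vertex_weight \<Gamma> x * \<bar>f $ x\<bar>)"

text \<open>Meaningful for \<open>1 \<le> k \<le> CARD('v)\<close> only; outside this range the real infimum and supremum may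
  range over empty sets. The same holds for \<open>cheeger\<close> below.\<close>

definition var_eigenvalue :: "'v::finite sgraph \<Rightarrow> nat \<Rightarrow> real" where
  "var_eigenvalue \<Gamma> k = (INF S\<in>genus_family \<Gamma> k. SUP f\<in>S. rayleigh1 \<Gamma> f)"

definition strong_nodal_walk :: "'v::finite sgraph \<Rightarrow> real ^ 'v \<Rightarrow> 'v list \<Rightarrow> bool" where
  "strong_nodal_walk \<Gamma> f xs \<longleftrightarrow> xs \<noteq> [] \<and>
     (\<forall>i. Suc i < length xs \<longrightarrow>
        adj \<Gamma> (xs ! i) (xs ! Suc i) \<and>
        f $ (xs ! i) * sg \<Gamma> (xs ! i) (xs ! Suc i) * f $ (xs ! Suc i) > 0)"

definition strong_nodal_rel :: "'v::finite sgraph \<Rightarrow> real ^ 'v \<Rightarrow> ('v \<times> 'v) set" where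
  "strong_nodal_rel \<Gamma> f =
     {(x, y). f $ x \<noteq> 0 \<and> f $ y \<noteq> 0 \<and>
        (x = y \<or> (\<exists>xs. strong_nodal_walk \<Gamma> f xs \<and> hd xs = x \<and> last xs = y))}"

definition strong_nodal_count :: "'v::finite sgraph \<Rightarrow> real ^ 'v \<Rightarrow> nat" where
  "strong_nodal_count \<Gamma> f = card ({x. f $ x \<noteq> 0} // strong_nodal_rel \<Gamma> f)"

text \<open>Each edge inside \<open>A\<close> is counted twice in \<open>edge_vol \<Gamma> s A A\<close>.\<close>

definition edge_vol :: "'v::finite sgraph \<Rightarrow> real \<Rightarrow> 'v set \<Rightarrow> 'v set \<Rightarrow> real" where
  "edge_vol \<Gamma> s A B = (\<Sum>x\<in>A. \<Sum>y | y \<in> B \<and> adj \<Gamma> x y \<and> sg \<Gamma> x y = s. wt \<Gamma> x y)"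

definition boundary_vol :: "'v::finite sgraph \<Rightarrow> 'v set \<Rightarrow> real" where
  "boundary_vol \<Gamma> A = (\<Sum>x\<in>A. \<Sum>y | y \<notin> A \<and> adj \<Gamma> x y. wt \<Gamma> x y)"

definition vertex_vol :: "'v::finite sgraph \<Rightarrow> 'v set \<Rightarrow> real" where
  "vertex_vol \<Gamma> A = (\<Sum>x\<in>A. vertex_weight \<Gamma> x)"

definition signed_ratio :: "'v::finite sgraph \<Rightarrow> 'v set \<Rightarrow> 'v set \<Rightarrow> real" where
  "signed_ratio \<Gamma> A B =
     (2 * edge_vol \<Gamma> 1 A B + edge_vol \<Gamma> (-1) A A + edge_vol \<Gamma> (-1) B B + boundary_vol \<Gamma> (A \<union> B))
     / vertex_vol \<Gamma> (A \<union> B)"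

definition admissible :: "nat \<Rightarrow> (nat \<Rightarrow> 'v set) \<Rightarrow> bool" where
  "admissible k V \<longleftrightarrow>
     (\<forall>i\<in>{1..k}. V (2 * i - 1) \<inter> V (2 * i) = {} \<and> V (2 * i - 1) \<union> V (2 * i) \<noteq> {}) \<and>
     (\<forall>i\<in>{1..k}. \<forall>j\<in>{1..k}. i \<noteq> j \<longrightarrow>
        (V (2 * i - 1) \<union> V (2 * i)) \<inter> (V (2 * j - 1) \<union> V (2 * j)) = {})"

definition cheeger :: "'v::finite sgraph \<Rightarrow> nat \<Rightarrow> real" where
  "cheeger \<Gamma> k =
     Min {MAX i\<in>{1..k}. signed_ratio \<Gamma> (V (2 * i - 1)) (V (2 * i)) | V. admissible k V}"

end

theory Submission
  imports Defs "HOL-Homology.Homology"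
begin

text \<open>
  Write \<open>E f\<close> for the numerator of the Rayleigh quotient (the \<^emph>\<open>energy\<close>) and \<open>N f\<close> for its
  denominator (the \<^emph>\<open>mass\<close>). Testing the eigenvalue equation of \<open>f\<close> with the sign of \<open>f\<close> on a single
  strong nodal domain gives a vector with entries in \<open>{-1, 0, 1}\<close> whose Rayleigh quotient is exactly the
  eigenvalue \<open>l\<close>; the Rayleigh quotient of such a vector is the signed Cheeger ratio of its two level
  sets. Hence the \<open>k\<close> nodal domains show \<open>h\<^sub>i \<le> l\<close> for \<open>i \<le> k\<close> (\<open>cheeger_le_eigenvalue\<close>). On the other
  hand \<open>\<lambda>\<^sub>i \<le> h\<^sub>i\<close> always (\<open>var_eigenvalue_le_cheeger\<close>): \<open>i\<close> disjointly supported vectors span an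
  \<open>i\<close>-dimensional space, \<open>E\<close> is subadditive and \<open>N\<close> is additive on disjoint supports, so the Rayleigh
  quotient on the span is at most the worst of the \<open>i\<close> ratios, and the unit sphere of the span has genus
  at least \<open>i\<close> by the Borsuk--Ulam theorem. So \<open>\<lambda>\<^sub>i \<le> h\<^sub>i \<le> l\<close>, and the equality follows as soon as
  \<open>l \<le> \<lambda>\<^sub>i\<close> or \<open>h\<^sub>i \<le> \<lambda>\<^sub>i\<close>.

  If \<open>l = \<lambda>\<^sub>1\<close>, or if \<open>l = \<lambda>\<^sub>2\<close> and \<open>i \<ge> 2\<close>, monotonicity of \<open>\<lambda>\<close> suffices. The two remaining cases rest on
  one existence result (\<open>eigenpair_below_genus_family\<close>): for a subspace \<open>K\<close> of the kernel of \<open>E\<close>, of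
  dimension \<open>p\<close>, some eigenfunction \<open>g\<close> has eigenvalue \<open>E g \<le> \<lambda>\<^bsub>p+1\<^esub>\<close>, and \<open>g\<close> is balanced against \<open>K\<close>,
  that is, some selection \<open>s\<close> of \<open>Sgn g\<close> is orthogonal to \<open>K\<close>. With \<open>K = {0}\<close> this gives an eigenfunction
  with eigenvalue at most \<open>\<lambda>\<^sub>1\<close>, and its nodal domains give \<open>h\<^sub>1 \<le> \<lambda>\<^sub>1\<close>. With \<open>K\<close> the whole kernel, the
  eigenvalue cannot vanish, since \<open>g \<in> K\<close> would give \<open>N g = 0\<close>; so the smallest positive eigenvalue is at
  most \<open>\<lambda>\<^bsub>p+1\<^esub> \<le> \<lambda>\<^sub>i\<close> for \<open>i > p\<close>. For \<open>i \<le> p\<close>, the kernel is spanned by disjointly supported sign vectors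
  and so \<open>h\<^sub>i \<le> 0 \<le> \<lambda>\<^sub>i\<close> (\<open>cheeger_nonpos_of_kernel_dim\<close>).

  The existence result replaces the usual deformation argument. Every symmetric compact set of genus
  greater than \<open>p\<close> contains a balanced vector: otherwise a regularised sign, paired with a basis of \<open>K\<close>,
  would be an odd map into the punctured \<open>p\<close>-dimensional space. So \<open>\<lambda>\<^bsub>p+1\<^esub>\<close> is at least the minimum of \<open>E\<close>
  over balanced unit vectors, and it remains to see that a minimiser \<open>g\<close> is an eigenfunction. Any \<open>h\<close>
  outside \<open>K\<close> can be moved by an element of \<open>K\<close> to a multiple of a balanced vector (the same statement,
  applied to the sphere of the span of \<open>K\<close> and \<open>h\<close>); this shows that \<open>E g\<close> times the pairing with \<open>s\<close> is
  a linear functional dominated by \<open>E\<close>, and such functionals are the divergences of edge flows bounded by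
  1 (\<open>energy_dual_flow\<close>).
\<close>

section \<open>The Borsuk--Ulam theorem\<close>

abbreviation seq_sphere :: "nat \<Rightarrow> (nat \<Rightarrow> real) set" where
  "seq_sphere n \<equiv> {x. (\<Sum>i\<le>n. (x i)\<^sup>2) = 1 \<and> (\<forall>i>n. x i = 0)}"

lemma nsphere_eq_top_of_set: "nsphere n = top_of_set (seq_sphere n)"
  by (simp add: nsphere euclidean_product_topology)

lemma continuous_map_nsphere_iff:
  "continuous_map (nsphere n) (nsphere m) f \<longleftrightarrow>
    continuous_on (seq_sphere n) f \<and> f \<in> seq_sphere n \<rightarrow> seq_sphere m"
  by (auto simp: nsphere_eq_top_of_set continuous_map_in_subtopology image_subset_iff Pi_iff)

lemma topspace_nsphere: "topspace (nsphere n) = seq_sphere n"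
  by (simp add: nsphere_eq_top_of_set)

definition normalize_seq :: "nat \<Rightarrow> (nat \<Rightarrow> real) \<Rightarrow> nat \<Rightarrow> real" where
  "normalize_seq n y i = (if i \<le> n then y i / sqrt (\<Sum>j\<le>n. (y j)\<^sup>2) else 0)"

lemma sum_squares_pos:
  fixes y :: "nat \<Rightarrow> real"
  assumes "\<exists>i\<le>n. y i \<noteq> 0"
  shows "(\<Sum>j\<le>n. (y j)\<^sup>2) > 0"
proof -
  obtain i where "i \<le> n" "y i \<noteq> 0" using assms by blast
  then show ?thesis by (intro sum_pos2[where i = i]) auto
qed

lemma normalize_seq_in_sphere:
  assumes "\<exists>i\<le>n. y i \<noteq> 0"
  shows "normalize_seq n y \<in> seq_sphere n"
proof -
  let ?s = "\<Sum>j\<le>n. (y j)\<^sup>2"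
  have "?s > 0" using sum_squares_pos[OF assms] .
  have "(\<Sum>i\<le>n. (normalize_seq n y i)\<^sup>2) = (\<Sum>i\<le>n. (y i)\<^sup>2 / ?s)"
    using \<open>?s > 0\<close> by (intro sum.cong) (auto simp: normalize_seq_def power_divide)
  also have "\<dots> = 1" using \<open>?s > 0\<close> by (simp flip: sum_divide_distrib)
  finally show ?thesis by (simp add: normalize_seq_def)
qed

lemma normalize_seq_id: "y \<in> seq_sphere n \<Longrightarrow> normalize_seq n y = y"
  by (auto simp: normalize_seq_def fun_eq_iff)

lemma normalize_seq_uminus: "normalize_seq n (\<lambda>i. - y i) = (\<lambda>i. - normalize_seq n y i)"
  by (auto simp: normalize_seq_def fun_eq_iff)

lemma continuous_on_normalize_seq:
  assumes "\<And>i. i \<le> n \<Longrightarrow> continuous_on X (\<lambda>x. h x i)"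
    and "\<And>x. x \<in> X \<Longrightarrow> \<exists>i\<le>n. h x i \<noteq> 0"
  shows "continuous_on X (\<lambda>x. normalize_seq n (h x))"
proof (rule continuous_on_coordinatewise_then_product)
  fix i
  have "continuous_on X (\<lambda>x. h x i / sqrt (\<Sum>j\<le>n. (h x j)\<^sup>2))" if "i \<le> n"
  proof (intro continuous_intros assms that)
    show "\<forall>x\<in>X. sqrt (\<Sum>j\<le>n. (h x j)\<^sup>2) \<noteq> 0"
      using sum_squares_pos[OF assms(2)] by fastforce
  qed auto
  then show "continuous_on X (\<lambda>x. normalize_seq n (h x) i)"
    by (cases "i \<le> n") (auto simp: normalize_seq_def)
qed

text \<open>
  Homotopies between self-maps of the sphere are most easily written in the surrounding space; it is
  enough that they avoid the origin.
\<close>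

lemma Brouwer_degree2_nonvanishing_homotopy:
  assumes cont: "\<And>i. i \<le> n \<Longrightarrow> continuous_on ({0..1::real} \<times> seq_sphere n) (\<lambda>(t, x). h t x i)"
    and nz: "\<And>t x. t \<in> {0..1} \<Longrightarrow> x \<in> seq_sphere n \<Longrightarrow> \<exists>i\<le>n. h t x i \<noteq> 0"
  shows "Brouwer_degree2 n (\<lambda>x. normalize_seq n (h 0 x)) = Brouwer_degree2 n (\<lambda>x. normalize_seq n (h 1 x))"
proof (rule Brouwer_degree2_homotopic)
  let ?H = "\<lambda>p. normalize_seq n (h (fst p) (snd p))"
  have "continuous_on ({0..1} \<times> seq_sphere n) ?H"
    using cont nz by (intro continuous_on_normalize_seq) (auto simp: case_prod_unfold)
  then have "continuous_map (prod_topology (top_of_set {0..1}) (nsphere n)) (nsphere n) ?H"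
    using normalize_seq_in_sphere[OF nz]
    by (auto simp: nsphere_eq_top_of_set continuous_map_in_subtopology image_subset_iff
        simp flip: subtopology_Times)
  then show "homotopic_with (\<lambda>x. True) (nsphere n) (nsphere n)
      (\<lambda>x. normalize_seq n (h 0 x)) (\<lambda>x. normalize_seq n (h 1 x))"
    unfolding homotopic_with_def by (intro exI[of _ ?H]) auto
qed

text \<open>
  The odd part of a polynomial approximation of an odd map is an approximation at least as good.
\<close>

lemma odd_polynomial_approximation:
  fixes F :: "'a::euclidean_space \<Rightarrow> 'a"
  assumes "subspace T" and cont: "continuous_on (sphere 0 1 \<inter> T) F"
    and FT: "F ` (sphere 0 1 \<inter> T) \<subseteq> T"
    and odd: "\<And>y. y \<in> sphere 0 1 \<inter> T \<Longrightarrow> F (- y) = - F y"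
    and "0 < e"
  obtains q where "polynomial_function q" "\<And>y. q (- y) = - q y"
    "q ` (sphere 0 1 \<inter> T) \<subseteq> T" "\<And>y. y \<in> sphere 0 1 \<inter> T \<Longrightarrow> norm (F y - q y) < e"
proof -
  let ?S = "sphere 0 1 \<inter> T"
  have "compact ?S"
    using \<open>subspace T\<close> by (intro compact_Int_closed closed_subspace) auto
  then obtain p where p: "polynomial_function p" "p ` ?S \<subseteq> T" "\<And>y. y \<in> ?S \<Longrightarrow> norm (F y - p y) < e"
    using Stone_Weierstrass_polynomial_function_subspace[OF _ cont \<open>0 < e\<close> \<open>subspace T\<close> FT] by blast
  define q where "q = (\<lambda>y. (1/2) *\<^sub>R (p y - p (- y)))"
  have sym: "- y \<in> ?S" if "y \<in> ?S" for y
    using that \<open>subspace T\<close> by (auto simp: subspace_neg)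
  show thesis
  proof
    have "polynomial_function (p \<circ> (\<lambda>y. - y))"
      by (intro polynomial_function_compose p polynomial_function_minus) simp
    then show "polynomial_function q"
      unfolding q_def o_def using p(1)
      by (intro polynomial_function_cmul polynomial_function_diff)
    show "q (- y) = - q y" for y by (simp add: q_def scaleR_diff_right)
    show "q ` ?S \<subseteq> T"
    proof clarify
      fix y assume "y \<in> sphere 0 1" "y \<in> T"
      then have "p y \<in> T" "p (- y) \<in> T" using p(2) sym[of y] by blast+
      then show "q y \<in> T"
        unfolding q_def using \<open>subspace T\<close> by (intro subspace_scale subspace_diff)
    qed
    fix y assume y: "y \<in> ?S"
    have "F y - q y = (1/2) *\<^sub>R ((F y - p y) - (F (- y) - p (- y)))"
      by (simp add: q_def odd[OF y] algebra_simps flip: scaleR_add_left)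
    also have "norm \<dots> \<le> 1/2 * (norm (F y - p y) + norm (F (- y) - p (- y)))"
      using norm_triangle_ineq4 by simp
    also have "\<dots> < e" using p(3)[OF y] p(3)[OF sym[OF y]] by simp
    finally show "norm (F y - q y) < e" .
  qed
qed

text \<open>
  An odd self-map of the sphere may well map the equator onto the whole sphere, but a differentiable map
  cannot, as the equator has smaller dimension. After a small perturbation \<open>g\<close> the image of the equator
  therefore misses a line through the origin: it misses a direction \<open>a\<close>, and \<open>-a\<close> as well by oddness.
  The inner product bound says that \<open>f x\<close> and \<open>g x\<close> are never opposite, so that the segment between them
  avoids the origin. The type \<open>'a\<close> provides a Euclidean space that contains the sphere, in which
  differentiability makes sense.
\<close>

lemma odd_map_perturbation_missing_direction:
  fixes f :: "(nat \<Rightarrow> real) \<Rightarrow> nat \<Rightarrow> real"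
  assumes dim: "n < DIM('a::euclidean_space)"
    and f: "continuous_on (seq_sphere n) f" "f \<in> seq_sphere n \<rightarrow> seq_sphere n"
    and odd: "\<And>x i. x \<in> seq_sphere n \<Longrightarrow> f (\<lambda>j. - x j) i = - f x i"
  obtains g a where "\<And>i. continuous_on (seq_sphere n) (\<lambda>x. g x i)"
    "\<And>x i. x \<in> seq_sphere n \<Longrightarrow> g (\<lambda>j. - x j) i = - g x i"
    "\<And>x. x \<in> seq_sphere n \<Longrightarrow> (\<Sum>i\<le>n. f x i * g x i) > 0"
    "a \<in> seq_sphere n"
    "\<And>x c. x \<in> seq_sphere n \<Longrightarrow> x n = 0 \<Longrightarrow> \<exists>i\<le>n. g x i \<noteq> c * a i"
proof -
  obtain b :: "nat \<Rightarrow> 'a" where b: "inj_on b {..n}" "b ` {..n} \<subseteq> Basis"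
  proof -
    obtain h :: "nat \<Rightarrow> 'a" where "bij_betw h {0..<DIM('a)} Basis"
      using ex_bij_betw_nat_finite[OF finite_Basis] by blast
    moreover have "{..n} \<subseteq> {0..<DIM('a)}" using dim by auto
    ultimately show thesis
      by (intro that[of h]) (auto simp: bij_betw_def intro: inj_on_subset)
  qed
  have bb: "b i \<bullet> b j = (if i = j then 1 else 0)" if "i \<le> n" "j \<le> n" for i j
    using b that by (auto simp: inner_Basis inj_on_eq_iff image_subset_iff)
  \<comment> \<open>\<open>\<Phi>\<close> and \<open>\<Psi>\<close> below identify the sphere of sequences with the unit sphere of \<open>T\<close>, and its equator with that of \<open>T'\<close>.\<close>
  define T where "T = span (b ` {..n})"
  define T' where "T' = span (b ` {..<n})"
  define \<Phi> where "\<Phi> x = (\<Sum>i\<le>n. x i *\<^sub>R b i)" for x :: "nat \<Rightarrow> real"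
  define \<Psi> where "\<Psi> y = (\<lambda>i. if i \<le> n then y \<bullet> b i else 0)" for y
  have sub: "subspace T" "subspace T'" "T' \<subseteq> T"
    by (auto simp: T_def T'_def intro!: span_mono)
  have dims: "dim T' < dim T"
  proof -
    have "independent (b ` {..n})"
      using b independent_Basis independent_mono by blast
    moreover have "independent (b ` {..<n})"
      using b independent_Basis independent_mono[of Basis "b ` {..<n}"] by fastforce
    moreover have "inj_on b {..<n}" using b(1) by (rule inj_on_subset) auto
    ultimately show ?thesis
      using b(1) by (simp add: T_def T'_def dim_eq_card_independent card_image)
  qed
  have \<Phi>T: "\<Phi> x \<in> T" for x
    unfolding \<Phi>_def T_def by (intro span_sum span_scale span_base) auto
  have \<Phi>T': "\<Phi> x \<in> T'" if "x n = 0" for x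
  proof -
    have "\<Phi> x = (\<Sum>i<n. x i *\<^sub>R b i)"
      using that by (simp add: \<Phi>_def flip: lessThan_Suc_atMost)
    also have "\<dots> \<in> T'"
      unfolding T'_def by (intro span_sum span_scale span_base) auto
    finally show ?thesis .
  qed
  have \<Phi>b: "\<Phi> x \<bullet> b i = x i" if "i \<le> n" for x i
    using that by (simp add: \<Phi>_def inner_sum_left bb if_distrib cong: if_cong)
  have inner\<Phi>: "\<Phi> x \<bullet> y = (\<Sum>i\<le>n. x i * (y \<bullet> b i))" for x y
    by (simp add: \<Phi>_def inner_sum_left inner_commute[of y])
  have \<Phi>\<Psi>: "\<Phi> (\<Psi> y) = y" if "y \<in> T" for y
  proof -
    have "y \<in> span (b ` {..n})" using that by (simp add: T_def)
    then show ?thesis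
    proof (induction rule: span_induct_alt)
      case base
      then show ?case by (simp add: \<Phi>_def \<Psi>_def)
    next
      case (step c x y)
      then obtain j where j: "j \<le> n" "x = b j" by auto
      have "\<Phi> (\<Psi> (c *\<^sub>R x + y)) = (\<Sum>i\<le>n. (c * (b j \<bullet> b i)) *\<^sub>R b i) + \<Phi> (\<Psi> y)"
        by (simp add: \<Phi>_def \<Psi>_def j algebra_simps sum.distrib)
      also have "(\<Sum>i\<le>n. (c * (b j \<bullet> b i)) *\<^sub>R b i) = (\<Sum>i\<le>n. if j = i then c *\<^sub>R b i else 0)"
        using j by (intro sum.cong) (auto simp: bb)
      also have "\<dots> = c *\<^sub>R x" using j by simp
      finally show ?case using step by simp
    qed
  qed
  have \<Psi>S: "\<Psi> y \<in> seq_sphere n" if "y \<in> sphere 0 1 \<inter> T" for y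
  proof -
    have "(\<Sum>i\<le>n. (\<Psi> y i)\<^sup>2) = \<Phi> (\<Psi> y) \<bullet> y"
      by (simp add: inner\<Phi> \<Psi>_def power2_eq_square)
    also have "\<dots> = 1" using that \<Phi>\<Psi>[of y] by (simp add: norm_eq_1)
    finally show ?thesis by (simp add: \<Psi>_def)
  qed
  have \<Phi>S: "\<Phi> x \<in> sphere 0 1 \<inter> T" if "x \<in> seq_sphere n" for x
    proof -
    have "\<Phi> x \<bullet> \<Phi> x = (\<Sum>i\<le>n. x i * x i)"
      unfolding inner\<Phi>[of x "\<Phi> x"] by (intro sum.cong) (auto simp: \<Phi>b)
    then show ?thesis using that \<Phi>T[of x] by (simp add: norm_eq_1 power2_eq_square)
  qed
  have cont\<Phi>: "continuous_on X \<Phi>" for X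
    unfolding \<Phi>_def
    by (intro continuous_intros continuous_on_subset[OF continuous_on_product_coordinates]) auto
  have cont\<Psi>: "continuous_on X \<Psi>" for X
      proof (rule continuous_on_coordinatewise_then_product)
    show "continuous_on X (\<lambda>y. \<Psi> y i)" for i
      by (cases "i \<le> n") (auto simp: \<Psi>_def intro!: continuous_intros)
  qed
  have \<Psi>\<Phi>: "\<Psi> (\<Phi> x) = x" if "x \<in> seq_sphere n" for x
    using that by (auto simp: \<Psi>_def \<Phi>b fun_eq_iff)
  define F where "F = \<Phi> \<circ> f \<circ> \<Psi>"
  let ?S = "sphere 0 1 \<inter> T"
  have "continuous_on ?S F"
    unfolding F_def using \<Psi>S
    by (intro continuous_on_compose cont\<Phi> cont\<Psi> continuous_on_subset[OF f(1)]) auto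
  moreover have FT: "F ` ?S \<subseteq> ?S"
    using \<Psi>S f(2) \<Phi>S unfolding F_def by (auto simp: Pi_iff)
  moreover have "F (- y) = - F y" if "y \<in> ?S" for y
  proof -
    have "\<Psi> (- y) = (\<lambda>j. - \<Psi> y j)" by (auto simp: \<Psi>_def)
    then show ?thesis using odd[OF \<Psi>S[OF that]] by (simp add: F_def \<Phi>_def sum_negf)
  qed
  ultimately obtain q where q: "polynomial_function q" "\<And>y. q (- y) = - q y"
      "q ` ?S \<subseteq> T" and near: "\<And>y. y \<in> ?S \<Longrightarrow> norm (F y - q y) < 1"
    using odd_polynomial_approximation[of T F 1] sub by auto
  have q0: "F y \<bullet> q y > 0" if "y \<in> ?S" for y
  proof -
    have "norm (F y) = 1" using FT that by (auto simp: image_subset_iff)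
    then have "F y \<bullet> q y = 1 - F y \<bullet> (F y - q y)" by (simp add: inner_diff_right norm_eq_1)
    moreover have "F y \<bullet> (F y - q y) < 1"
      using norm_cauchy_schwarz[of "F y" "F y - q y"] near[OF that] \<open>norm (F y) = 1\<close> by simp
    ultimately show ?thesis by simp
  qed
  define G where "G y = q y /\<^sub>R norm (q y)" for y
  have qnz: "q y \<noteq> 0" if "y \<in> ?S" for y using q0[OF that] by auto
  have "G differentiable_on (sphere 0 1 \<inter> T')"
  proof -
    have "q differentiable_on (sphere 0 1 \<inter> T')"
      using q(1) by (rule differentiable_on_polynomial_function)
    moreover have "norm differentiable_on (q ` (sphere 0 1 \<inter> T'))"
    proof (rule differentiable_on_norm)
      show "0 \<notin> q ` (sphere 0 1 \<inter> T')"
      proof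
        assume "0 \<in> q ` (sphere 0 1 \<inter> T')"
        then obtain y where y: "0 = q y" "y \<in> sphere 0 1 \<inter> T'" by (rule imageE)
        from y(2) sub(3) have "y \<in> ?S" by blast
        from qnz[OF this] y(1) show False by simp
      qed
    qed
    ultimately have "(\<lambda>y. norm (q y)) differentiable_on (sphere 0 1 \<inter> T')"
      by (rule differentiable_on_compose)
    moreover have "norm (q y) \<noteq> 0" if "y \<in> sphere 0 1 \<inter> T'" for y
      using that qnz[of y] sub(3) by auto
    ultimately have "(\<lambda>y. inverse (norm (q y)) *\<^sub>R q y) differentiable_on (sphere 0 1 \<inter> T')"
      using \<open>q differentiable_on _\<close> by (intro differentiable_on_scaleR differentiable_on_inverse)
    then show ?thesis by (simp add: G_def[abs_def])
  qed
  from spheremap_lemma1[OF sub(2,1) dims sub(3) this]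
  have "G ` (sphere 0 1 \<inter> T') \<noteq> ?S" .
  moreover have "G ` (sphere 0 1 \<inter> T') \<subseteq> ?S"
  proof (rule image_subsetI)
    fix y assume "y \<in> sphere 0 1 \<inter> T'"
    then have "y \<in> ?S" using sub(3) by blast
    then have "q y \<in> T" "q y \<noteq> 0" using q(3) qnz by blast+
    then show "G y \<in> ?S" unfolding G_def by (simp add: subspace_scale[OF sub(1)])
  qed
  ultimately obtain a where a: "a \<in> ?S" "a \<notin> G ` (sphere 0 1 \<inter> T')" by blast
  show thesis
  proof (rule that[of "\<lambda>x. \<Psi> (q (\<Phi> x))" "\<Psi> a"])
    show "continuous_on (seq_sphere n) (\<lambda>x. \<Psi> (q (\<Phi> x)) i)" for i
    proof -
      have "continuous_on (seq_sphere n) (q \<circ> \<Phi>)"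
        by (intro continuous_on_compose cont\<Phi> continuous_on_polymonial_function q(1))
      then have "continuous_on (seq_sphere n) (\<Psi> \<circ> (q \<circ> \<Phi>))"
        by (rule continuous_on_compose) (rule cont\<Psi>)
      from continuous_on_product_then_coordinatewise[OF this] show ?thesis by simp
    qed
    show "\<Psi> (q (\<Phi> (\<lambda>j. - x j))) i = - \<Psi> (q (\<Phi> x)) i" for x i
    proof -
      have "\<Phi> (\<lambda>j. - x j) = - \<Phi> x" by (simp add: \<Phi>_def sum_negf)
      then show ?thesis by (simp add: q(2) \<Psi>_def)
    qed
    show "(\<Sum>i\<le>n. f x i * \<Psi> (q (\<Phi> x)) i) > 0" if "x \<in> seq_sphere n" for x
    proof -
      have "F (\<Phi> x) \<bullet> q (\<Phi> x) = (\<Sum>i\<le>n. f x i * \<Psi> (q (\<Phi> x)) i)"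
        using \<Psi>\<Phi>[OF that] by (simp add: F_def inner\<Phi> \<Psi>_def)
      then show ?thesis using q0[OF \<Phi>S[OF that]] by simp
    qed
    show "\<Psi> a \<in> seq_sphere n" by (rule \<Psi>S[OF a(1)])
    show "\<exists>i\<le>n. \<Psi> (q (\<Phi> x)) i \<noteq> c * \<Psi> a i" if x: "x \<in> seq_sphere n" "x n = 0" for x c
    proof (rule ccontr)
      assume "\<not> ?thesis"
      then have eq: "\<Psi> (q (\<Phi> x)) = (\<lambda>i. c * \<Psi> a i)" by (auto simp: \<Psi>_def fun_eq_iff)
      let ?y = "\<Phi> x"
      have y: "?y \<in> ?S" "?y \<in> sphere 0 1 \<inter> T'" using \<Phi>S[OF x(1)] \<Phi>T'[of x, OF x(2)] by auto
      have "\<Phi> (\<lambda>i. c * \<Psi> a i) = c *\<^sub>R \<Phi> (\<Psi> a)" by (simp add: \<Phi>_def scaleR_sum_right)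
      then have qa: "q ?y = c *\<^sub>R a"
        using \<Phi>\<Psi>[of "q ?y"] \<Phi>\<Psi>[of a] eq q(3) y a by (auto simp: image_subset_iff)
      then have "c \<noteq> 0" using qnz[OF y(1)] by auto
      have [simp]: "norm a = 1" using a by simp
      show False
      proof (cases "c > 0")
        case True
        then have "G ?y = a" by (simp add: G_def qa)
        then show False using a y by blast
      next
        case False
        then have "G (- ?y) = a" using \<open>c \<noteq> 0\<close> by (simp add: G_def q(2) qa)
        moreover have "- ?y \<in> sphere 0 1 \<inter> T'"
          using y(2) subspace_neg[OF sub(2), of ?y] by simp
        ultimately show False using a by blast
      qed
    qed
  qed
qed

text \<open>
  The orthogonal reflection in the hyperplane perpendicular to \<open>v\<close>. For \<open>v = 0\<close> the division by zero makes
  it the identity, which is what \<open>householder_swap\<close> needs when the two points coincide.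
\<close>

definition householder :: "nat \<Rightarrow> (nat \<Rightarrow> real) \<Rightarrow> (nat \<Rightarrow> real) \<Rightarrow> nat \<Rightarrow> real" where
  "householder n v y i = y i - 2 * (\<Sum>j\<le>n. y j * v j) / (\<Sum>j\<le>n. v j * v j) * v i"

lemma householder_uminus: "householder n v (\<lambda>i. - y i) = (\<lambda>i. - householder n v y i)"
  by (rule ext) (simp add: householder_def sum_negf)

lemma householder_self_adjoint:
  "(\<Sum>i\<le>n. householder n v y i * z i) = (\<Sum>i\<le>n. y i * householder n v z i)"
proof -
  define k where "k y = 2 * (\<Sum>j\<le>n. y j * v j) / (\<Sum>j\<le>n. v j * v j)" for y
  have h: "householder n v y i = y i - k y * v i" for y i
    by (simp add: householder_def k_def)
  have "(\<Sum>i\<le>n. householder n v y i * z i) = (\<Sum>i\<le>n. y i * z i) - k y * (\<Sum>i\<le>n. z i * v i)"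
    unfolding h sum_distrib_left sum_subtractf[symmetric]
    by (intro sum.cong) (auto simp: algebra_simps)
  moreover have "(\<Sum>i\<le>n. y i * householder n v z i) = (\<Sum>i\<le>n. y i * z i) - k z * (\<Sum>i\<le>n. y i * v i)"
    unfolding h sum_distrib_left sum_subtractf[symmetric]
    by (intro sum.cong) (auto simp: algebra_simps)
  ultimately show ?thesis by (simp add: k_def)
qed

lemma householder_in_sphere:
  assumes "\<And>i. i > n \<Longrightarrow> v i = 0" and y: "y \<in> seq_sphere n"
  shows "householder n v y \<in> seq_sphere n"
proof -
  let ?d = "\<Sum>j\<le>n. v j * v j" and ?c = "\<Sum>j\<le>n. y j * v j"
  define k where "k = 2 * ?c / ?d"
  have "(\<Sum>i\<le>n. (householder n v y i)\<^sup>2)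
      = (\<Sum>i\<le>n. (y i)\<^sup>2 - 2 * k * (y i * v i) + k\<^sup>2 * (v i * v i))"
    unfolding householder_def k_def[symmetric]
    by (intro sum.cong) (auto simp: power2_eq_square algebra_simps)
  also have "\<dots> = (\<Sum>i\<le>n. (y i)\<^sup>2) - 2 * k * ?c + k\<^sup>2 * ?d"
    by (simp add: sum.distrib sum_subtractf flip: sum_distrib_left)
  also have "\<dots> = 1"
    using y by (cases "?d = 0") (auto simp: k_def power2_eq_square)
  finally show ?thesis using assms by (auto simp: householder_def)
qed

lemma householder_swap:
  assumes a: "a \<in> seq_sphere n" and b: "b \<in> seq_sphere n"
  shows "householder n (\<lambda>i. a i - b i) b = a"
proof
  fix i
  let ?v = "\<lambda>i. a i - b i"
  have d: "(\<Sum>j\<le>n. ?v j * ?v j) = - 2 * (\<Sum>j\<le>n. b j * ?v j)"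
  proof -
    have "(\<Sum>j\<le>n. ?v j * ?v j) = (\<Sum>j\<le>n. (a j)\<^sup>2 - (b j)\<^sup>2 - 2 * (b j * ?v j))"
      by (intro sum.cong) (auto simp: power2_eq_square algebra_simps)
    also have "\<dots> = - 2 * (\<Sum>j\<le>n. b j * ?v j)"
      using a b by (simp add: sum_subtractf flip: sum_distrib_left)
    finally show ?thesis .
  qed
  show "householder n ?v b i = a i"
  proof (cases "(\<Sum>j\<le>n. ?v j * ?v j) = 0")
    case True
    have "?v i = 0"
    proof (cases "i \<le> n")
      case i: True
      have "\<forall>j\<in>{..n}. ?v j * ?v j = 0"
        using True by (subst (asm) sum_nonneg_eq_0_iff) auto
      then show ?thesis using i by auto
    qed (use a b in auto)
    then show ?thesis by (simp add: householder_def)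
  next
    case False
    then show ?thesis unfolding householder_def d by simp
  qed
qed

text \<open>
  Induction on the dimension. A map that also preserves the equator has the same degree modulo 2 as its
  restriction to the equator (\<open>Borsuk_odd_mapping_degree_step\<close>), so the given map has to be deformed into
  an odd map with this property. By the perturbation lemma the image of the equator may be assumed to avoid
  the line spanned by some \<open>a\<close>. Subtracting the \<open>a\<close>-component on the equator, and less and less of it away from
  the equator, pushes the image of the equator into the hyperplane perpendicular to \<open>a\<close>; a reflection that
  swaps \<open>a\<close> with the pole then carries this hyperplane to the equator.
\<close>

theorem Borsuk_odd_degree:
  fixes f :: "(nat \<Rightarrow> real) \<Rightarrow> nat \<Rightarrow> real"
  assumes "n < DIM('a::euclidean_space)"
    and "continuous_on (seq_sphere n) f" "f \<in> seq_sphere n \<rightarrow> seq_sphere n"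
    and "\<And>x i. x \<in> seq_sphere n \<Longrightarrow> f (\<lambda>j. - x j) i = - f x i"
  shows "odd (Brouwer_degree2 n f)"
  using assms
proof (induction n arbitrary: f)
  case 0
  define e :: "nat \<Rightarrow> real" where "e = (\<lambda>i. if i = 0 then 1 else 0)"
  have S0: "x = e \<or> x = (\<lambda>i. - e i)" if "x \<in> seq_sphere 0" for x
  proof -
    have "x 0 = 1 \<or> x 0 = - 1" "\<forall>i>0. x i = 0"
      using that by (auto simp: power2_eq_1_iff)
    then show ?thesis by (auto simp: fun_eq_iff e_def)
  qed
  have e: "e \<in> seq_sphere 0" by (simp add: e_def)
  have "f (\<lambda>i. - e i) = (\<lambda>i. - f e i)" using "0.prems"(4)[OF e] by auto
  consider "f e = e" | "f e = (\<lambda>i. - e i)" using S0 "0.prems"(3) e by blast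
  then show ?case
  proof cases
    case 1
    then have "f x = id x" if "x \<in> topspace (nsphere 0)" for x
      using S0 \<open>f (\<lambda>i. - e i) = _\<close> that by (auto simp: topspace_nsphere)
    then show ?thesis
      by (subst Brouwer_degree2_eq[of 0 f id]) auto
  next
    case 2
    have "f x = (\<lambda>i. if i = 0 then - x i else x i)" if "x \<in> topspace (nsphere 0)" for x
    proof -
      have "x = e \<or> x = (\<lambda>i. - e i)" using S0 that by (auto simp: topspace_nsphere)
      then show ?thesis
      proof
        assume "x = e"
        then show ?thesis using 2 by (auto simp: e_def)
      next
        assume "x = (\<lambda>i. - e i)"
        then have "f x = e" using 2 \<open>f (\<lambda>i. - e i) = _\<close> by auto
        then show ?thesis using \<open>x = _\<close> by (auto simp: e_def)
      qed
    qed
    then show ?thesis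
      by (subst Brouwer_degree2_eq[of 0 f "\<lambda>x i. if i = 0 then - x i else x i"])
        (auto simp: Brouwer_degree2_reflection)
  qed
next
  case (Suc m)
  let ?n = "Suc m"
  note f = Suc.prems(2,3,4)
  obtain g a where gcont: "\<And>i. continuous_on (seq_sphere ?n) (\<lambda>x. g x i)"
    and godd: "\<And>x i. x \<in> seq_sphere ?n \<Longrightarrow> g (\<lambda>j. - x j) i = - g x i"
    and fg: "\<And>x. x \<in> seq_sphere ?n \<Longrightarrow> (\<Sum>i\<le>?n. f x i * g x i) > 0"
    and a: "a \<in> seq_sphere ?n"
    and ga: "\<And>x c. x \<in> seq_sphere ?n \<Longrightarrow> x ?n = 0 \<Longrightarrow> \<exists>i\<le>?n. g x i \<noteq> c * a i"
  proof -
    show thesis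
      by (rule odd_map_perturbation_missing_direction[OF Suc.prems]) (assumption | rule that)+
  qed
  define s where "s x = (\<Sum>i\<le>?n. g x i * a i)" for x
  \<comment> \<open>The factor \<open>1 - \<bar>x ?n\<bar>\<close> is even in \<open>x\<close>, so that oddness is kept, and equals 1 on the equator only, so that the image of \<open>h 1\<close> avoids the origin away from the equator.\<close>
  define h where "h t x i = g x i - t * (1 - \<bar>x ?n\<bar>) * s x * a i" for t x i
  have scont: "continuous_on (seq_sphere ?n) s"
    unfolding s_def by (intro continuous_intros gcont)
  have xcont: "continuous_on X (\<lambda>x. x i)" for X :: "(nat \<Rightarrow> real) set" and i
    by (rule continuous_on_subset[OF continuous_on_product_coordinates]) auto
  have xn: "\<bar>x ?n\<bar> \<le> 1" if "x \<in> seq_sphere ?n" for x :: "nat \<Rightarrow> real"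
  proof -
    have "(x ?n)\<^sup>2 \<le> (\<Sum>i\<le>?n. (x i)\<^sup>2)" by (rule member_le_sum) auto
    also have "\<dots> = 1" using that by blast
    finally show ?thesis by (simp add: abs_square_le_1)
  qed
  have gnz: "\<exists>i\<le>?n. g x i \<noteq> 0" if "x \<in> seq_sphere ?n" for x
  proof (rule ccontr)
    assume "\<not> ?thesis"
    then have "(\<Sum>i\<le>?n. f x i * g x i) = 0" by (intro sum.neutral) auto
    then show False using fg[OF that] by simp
  qed
  have hnz: "\<exists>i\<le>?n. h t x i \<noteq> 0" if t: "t \<in> {0..1}" and x: "x \<in> seq_sphere ?n" for t x
  proof (rule ccontr)
    assume zero: "\<not> ?thesis"
    define c where "c = t * (1 - \<bar>x ?n\<bar>) * s x"
    have g: "g x i = c * a i" if "i \<le> ?n" for i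
      using zero that by (auto simp: h_def c_def)
    then have "x ?n \<noteq> 0" using ga[OF x] by blast
    have "s x = (\<Sum>i\<le>?n. c * (a i)\<^sup>2)"
      unfolding s_def using g by (intro sum.cong) (simp_all add: power2_eq_square)
    also have "\<dots> = c" using a by (simp flip: sum_distrib_left)
    also have "\<dots> = t * (1 - \<bar>x ?n\<bar>) * s x" by (rule c_def)
    finally have "s x = 0 \<or> t * (1 - \<bar>x ?n\<bar>) = 1" by auto
    moreover have "t * (1 - \<bar>x ?n\<bar>) < 1"
    proof -
      have "t * (1 - \<bar>x ?n\<bar>) \<le> 1 * (1 - \<bar>x ?n\<bar>)"
        using t xn[OF x] by (intro mult_right_mono) auto
      then show ?thesis using \<open>x ?n \<noteq> 0\<close> by simp
    qed
    ultimately have "c = 0" by (auto simp: c_def)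
    then show False using gnz[OF x] g by auto
  qed
  define k where "k x = normalize_seq ?n (h 1 x)" for x
  have "Brouwer_degree2 ?n (\<lambda>x. normalize_seq ?n (\<lambda>i. (1 - 0) * f x i + 0 * g x i))
      = Brouwer_degree2 ?n (\<lambda>x. normalize_seq ?n (\<lambda>i. (1 - 1) * f x i + 1 * g x i))"
  proof (rule Brouwer_degree2_nonvanishing_homotopy)
    fix i
    show "continuous_on ({0..1::real} \<times> seq_sphere ?n) (\<lambda>(t, x). (1 - t) * f x i + t * g x i)"
      unfolding case_prod_unfold
      by (intro continuous_intros
          continuous_on_compose2[OF gcont continuous_on_snd]
          continuous_on_compose2[OF continuous_on_product_then_coordinatewise[OF f(1)] continuous_on_snd])
        auto
  next
    fix t :: real and x assume t: "t \<in> {0..1}" and x: "x \<in> seq_sphere ?n"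
    show "\<exists>i\<le>?n. (1 - t) * f x i + t * g x i \<noteq> 0"
    proof (rule ccontr)
      assume "\<not> ?thesis"
      then have "0 = (\<Sum>i\<le>?n. f x i * ((1 - t) * f x i + t * g x i))" by simp
      also have "\<dots> = (1 - t) * (\<Sum>i\<le>?n. (f x i)\<^sup>2) + t * (\<Sum>i\<le>?n. f x i * g x i)"
        unfolding sum_distrib_left sum.distrib[symmetric]
        by (intro sum.cong) (auto simp: power2_eq_square algebra_simps)
      also have "(\<Sum>i\<le>?n. (f x i)\<^sup>2) = 1" using f(2) x by blast
      finally have zero: "0 = (1 - t) * 1 + t * (\<Sum>i\<le>?n. f x i * g x i)" .
      show False
      proof (cases "t = 0")
        case True
        then show False using zero by simp
      next
        case False
        then have "t * (\<Sum>i\<le>?n. f x i * g x i) > 0"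
          using t fg[OF x] by (intro mult_pos_pos) auto
        moreover have "(1 - t) * 1 \<ge> 0" using t by simp
        ultimately show False using add_nonneg_pos zero less_irrefl by metis
      qed
    qed
  qed
  moreover have "Brouwer_degree2 ?n (\<lambda>x. normalize_seq ?n (\<lambda>i. (1 - 0) * f x i + 0 * g x i)) = Brouwer_degree2 ?n f"
  proof (rule Brouwer_degree2_eq)
    fix x assume "x \<in> topspace (nsphere ?n)"
    then have "f x \<in> seq_sphere ?n" using f(2) by (auto simp: topspace_nsphere Pi_iff)
    then show "normalize_seq ?n (\<lambda>i. (1 - 0) * f x i + 0 * g x i) = f x"
      using normalize_seq_id by simp
  qed
  moreover have "Brouwer_degree2 ?n (\<lambda>x. normalize_seq ?n (h 0 x)) = Brouwer_degree2 ?n (\<lambda>x. normalize_seq ?n (h 1 x))"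
  proof (rule Brouwer_degree2_nonvanishing_homotopy)
    fix i
    show "continuous_on ({0..1::real} \<times> seq_sphere ?n) (\<lambda>(t, x). h t x i)"
      unfolding case_prod_unfold h_def
      by (intro continuous_intros
          continuous_on_compose2[OF gcont continuous_on_snd]
          continuous_on_compose2[OF scont continuous_on_snd]
          continuous_on_compose2[OF xcont[of UNIV] continuous_on_snd]) auto
  qed (use hnz in auto)
  moreover have "h 0 = g" by (auto simp: h_def fun_eq_iff)
  ultimately have deg: "Brouwer_degree2 ?n f = Brouwer_degree2 ?n k"
    by (simp add: k_def[abs_def])
  define e :: "nat \<Rightarrow> real" where "e = (\<lambda>i. if i = ?n then 1 else 0)"
  have e: "e \<in> seq_sphere ?n"
    by (simp add: e_def if_distrib[of "\<lambda>x. x\<^sup>2"] cong: if_cong)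
  define R where "R = householder ?n (\<lambda>i. a i - e i)"
  have kcont: "continuous_on (seq_sphere ?n) k"
    unfolding k_def[abs_def] h_def[abs_def]
    using hnz[of 1, unfolded h_def]
    by (intro continuous_on_normalize_seq continuous_intros gcont scont xcont) auto
  have kS: "k \<in> seq_sphere ?n \<rightarrow> seq_sphere ?n"
    using normalize_seq_in_sphere[OF hnz[of 1]] unfolding k_def by auto
  have kodd: "k (\<lambda>j. - x j) = (\<lambda>i. - k x i)" if "x \<in> seq_sphere ?n" for x
  proof -
    have "h 1 (\<lambda>j. - x j) = (\<lambda>i. - h 1 x i)"
      using godd[OF that] by (auto simp: h_def s_def sum_negf algebra_simps)
    then show ?thesis by (simp add: k_def normalize_seq_uminus)
  qed
  have Rcont: "continuous_on X R" for X
  proof (rule continuous_on_coordinatewise_then_product)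
    show "continuous_on X (\<lambda>y. R y i)" for i
      unfolding R_def householder_def divide_inverse
      by (intro continuous_on_diff continuous_on_mult continuous_on_sum continuous_on_const xcont)
  qed
  have RS: "R \<in> seq_sphere ?n \<rightarrow> seq_sphere ?n"
    using householder_in_sphere[of ?n "\<lambda>i. a i - e i"] a e unfolding R_def by auto
  have Rodd: "R (\<lambda>i. - y i) = (\<lambda>i. - R y i)" for y
    unfolding R_def by (rule householder_uminus)
  have equator: "R (k x) ?n = 0" if x: "x \<in> seq_sphere ?n" "x ?n = 0" for x
  proof -
    have "R (k x) ?n = (\<Sum>i\<le>?n. R (k x) i * e i)"
      by (simp add: e_def if_distrib cong: if_cong)
    also have "\<dots> = (\<Sum>i\<le>?n. k x i * a i)"
      unfolding R_def householder_self_adjoint householder_swap[OF a e] ..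
    also have "\<dots> = (\<Sum>i\<le>?n. h 1 x i * a i) / sqrt (\<Sum>j\<le>?n. (h 1 x j)\<^sup>2)"
      unfolding k_def sum_divide_distrib by (intro sum.cong) (auto simp: normalize_seq_def)
    also have "(\<Sum>i\<le>?n. h 1 x i * a i) = s x - s x * (\<Sum>i\<le>?n. (a i)\<^sup>2)"
      unfolding s_def[of x] sum_distrib_left sum_subtractf[symmetric]
      using x by (intro sum.cong) (auto simp: h_def s_def power2_eq_square algebra_simps)
    also have "\<dots> = 0" using a by simp
    finally show ?thesis by simp
  qed
  let ?f = "R \<circ> k"
  have cont: "continuous_on (seq_sphere ?n) ?f"
    by (intro continuous_on_compose kcont Rcont)
  have maps: "?f \<in> seq_sphere ?n \<rightarrow> seq_sphere ?n"
    unfolding comp_def by (rule Pi_I) (rule funcset_mem[OF RS funcset_mem[OF kS]])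
  have odd: "?f (\<lambda>j. - x j) = (\<lambda>i. - ?f x i)" if "x \<in> seq_sphere ?n" for x
    using kodd[OF that] Rodd by simp
  have sub: "x \<in> seq_sphere m \<longleftrightarrow> x \<in> seq_sphere ?n \<and> x ?n = 0" for x :: "nat \<Rightarrow> real"
    by (auto simp: le_less_Suc_eq not_less_eq less_Suc_eq) (metis Suc_lessI)
  have maps': "?f \<in> seq_sphere m \<rightarrow> seq_sphere m"
  proof (rule Pi_I)
    fix x assume "x \<in> seq_sphere m"
    then have x: "x \<in> seq_sphere ?n" "x ?n = 0" by (simp_all only: sub)
    show "?f x \<in> seq_sphere m"
      unfolding sub using funcset_mem[OF maps x(1)] equator[OF x] by (simp only: o_apply)
  qed
  have "odd (Brouwer_degree2 m ?f)"
  proof (rule Suc.IH)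
    show "m < DIM('a)" using Suc.prems(1) by simp
    show "continuous_on (seq_sphere m) ?f"
      by (rule continuous_on_subset[OF cont]) (unfold sub subset_iff, iprover)
    show "?f (\<lambda>j. - x j) i = - ?f x i" if "x \<in> seq_sphere m" for x i
      by (simp only: odd[OF that[unfolded sub, THEN conjunct1]])
  qed (rule maps')
  moreover have "even (Brouwer_degree2 ?n ?f - Brouwer_degree2 (?n - Suc 0) ?f)"
  proof (rule Borsuk_odd_mapping_degree_step)
    show "continuous_map (nsphere ?n) (nsphere ?n) ?f"
      using cont maps by (simp only: continuous_map_nsphere_iff)
    show "(?f \<circ> (\<lambda>x i. - x i)) u = ((\<lambda>x i. - x i) \<circ> ?f) u" if "u \<in> topspace (nsphere ?n)" for u
      using odd[of u] that by (simp add: topspace_nsphere)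
    show "?f \<in> topspace (nsphere (?n - Suc 0)) \<rightarrow> topspace (nsphere (?n - Suc 0))"
      using maps' by (simp add: topspace_nsphere)
  qed
  ultimately have "odd (Brouwer_degree2 ?n ?f)" by simp
  moreover have "Brouwer_degree2 ?n ?f = Brouwer_degree2 ?n R * Brouwer_degree2 ?n k"
    using kcont kS Rcont RS
    by (intro Brouwer_degree2_compose) (simp_all only: continuous_map_nsphere_iff)
  ultimately show ?case using deg by simp
qed

text \<open>
  Seen as a self-map of the larger sphere, an odd map into the smaller one would be nonsurjective and thus
  of degree zero.
\<close>

theorem Borsuk_Ulam:
  fixes f :: "(nat \<Rightarrow> real) \<Rightarrow> nat \<Rightarrow> real"
  assumes n: "n < DIM('a::euclidean_space)" and "m < n"
    and f: "continuous_on (seq_sphere n) f" "f \<in> seq_sphere n \<rightarrow> seq_sphere m"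
  shows "\<exists>x\<in>seq_sphere n. \<exists>i. f (\<lambda>j. - x j) i \<noteq> - f x i"
proof (rule ccontr)
  assume "\<not> ?thesis"
  then have odd: "f (\<lambda>j. - x j) i = - f x i" if "x \<in> seq_sphere n" for x i using that by auto
  have sub: "seq_sphere m \<subseteq> seq_sphere n"
  proof clarify
    fix x :: "nat \<Rightarrow> real" assume x: "(\<Sum>i\<le>m. (x i)\<^sup>2) = 1" "\<forall>i>m. x i = 0"
    have "(\<Sum>i\<le>n. (x i)\<^sup>2) = (\<Sum>i\<le>m. (x i)\<^sup>2)"
      using x \<open>m < n\<close> by (intro sum.mono_neutral_right) auto
    then show "(\<Sum>i\<le>n. (x i)\<^sup>2) = 1 \<and> (\<forall>i>n. x i = 0)" using x \<open>m < n\<close> by auto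
  qed
  have maps: "f \<in> seq_sphere n \<rightarrow> seq_sphere n"     by (rule Pi_I) (rule subsetD[OF sub funcset_mem[OF f(2)]])
  have "odd (Brouwer_degree2 n f)"
    by (rule Borsuk_odd_degree[OF n f(1) maps]) (rule odd)
  moreover have "Brouwer_degree2 n f = 0"
  proof (rule Brouwer_degree2_nonsurjective)
    show "continuous_map (nsphere n) (nsphere n) f"
      using f(1) maps by (simp only: continuous_map_nsphere_iff)
    define e :: "nat \<Rightarrow> real" where "e = (\<lambda>i. if i = n then 1 else 0)"
    have e: "e \<in> seq_sphere n" by (simp add: e_def if_distrib[of "\<lambda>x. x\<^sup>2"] cong: if_cong)
    have e': "e \<notin> seq_sphere m" using \<open>m < n\<close> by (auto simp: e_def)
    have image: "f ` seq_sphere n \<subseteq> seq_sphere m" using f(2) by (rule funcset_image)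
    show "f ` topspace (nsphere n) \<noteq> topspace (nsphere n)"
      unfolding topspace_nsphere
    proof
      assume eq: "f ` seq_sphere n = seq_sphere n"
      have "e \<in> f ` seq_sphere n" unfolding eq by (rule e)
      from e' subsetD[OF image this] show False by (rule notE)
    qed
  qed
  ultimately show False by simp
qed

section \<open>Energy and mass on a signed graph\<close>

text \<open>
  In this form membership is a closed condition on the pair \<open>(s, t)\<close>.
\<close>

lemma in_Sgn_iff: "s \<in> Sgn t \<longleftrightarrow> \<bar>s\<bar> \<le> 1 \<and> s * t = \<bar>t\<bar>"
proof (cases t "0 :: real" rule: linorder_cases)
  case less
  then have "s * t = - t \<longleftrightarrow> s = - 1"
    using mult_cancel_right[of s t "- 1"] by simp
  then show ?thesis using less by (auto simp: Sgn_def)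
qed (auto simp: Sgn_def abs_le_iff)

locale weighted_signed_graph =
  fixes \<Gamma> :: "'v::finite sgraph"
  assumes signed: "signed_graph \<Gamma>"
begin

abbreviation "\<mu> \<equiv> vertex_weight \<Gamma>"
abbreviation "\<sigma> \<equiv> sg \<Gamma>"
abbreviation "w \<equiv> wt \<Gamma>"

definition energy :: "real ^ 'v \<Rightarrow> real" where
  "energy f = 1/2 * (\<Sum>x\<in>UNIV. \<Sum>y | adj \<Gamma> x y. w x y * \<bar>f $ x - \<sigma> x y * f $ y\<bar>)"

definition mass :: "real ^ 'v \<Rightarrow> real" where
  "mass f = (\<Sum>x\<in>UNIV. \<mu> x * \<bar>f $ x\<bar>)"

lemma rayleigh1_eq: "rayleigh1 \<Gamma> f = energy f / mass f"
  by (simp add: rayleigh1_def energy_def mass_def)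

lemma unit_sphere1_eq: "unit_sphere1 \<Gamma> = {f. mass f = 1}"
  by (simp add: unit_sphere1_def mass_def)

lemma \<mu>_pos: "\<mu> x > 0"
  using signed by (simp add: signed_graph_def)

lemma w_pos: "adj \<Gamma> x y \<Longrightarrow> w x y > 0"
  using signed by (simp add: signed_graph_def adj_def wt_def)

lemma \<sigma>_cases: "adj \<Gamma> x y \<Longrightarrow> \<sigma> x y = 1 \<or> \<sigma> x y = - 1"
  using signed by (auto simp: signed_graph_def adj_def sg_def)

lemma \<sigma>_square: "adj \<Gamma> x y \<Longrightarrow> \<sigma> x y * \<sigma> x y = 1"
  using \<sigma>_cases by fastforce

lemma adj_sym: "adj \<Gamma> x y \<longleftrightarrow> adj \<Gamma> y x"
  by (simp add: adj_def insert_commute)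

lemma w_sym: "w x y = w y x"
  by (simp add: wt_def insert_commute)

lemma \<sigma>_sym: "\<sigma> x y = \<sigma> y x"
  by (simp add: sg_def insert_commute)

lemma arc_sum_swap:
  fixes g :: "'v \<Rightarrow> 'v \<Rightarrow> real"
  shows "(\<Sum>x\<in>UNIV. \<Sum>y | adj \<Gamma> x y. g x y) = (\<Sum>x\<in>UNIV. \<Sum>y | adj \<Gamma> x y. g y x)"
  using sum.swap_restrict[of UNIV UNIV g "adj \<Gamma>"] adj_sym by simp

text \<open>
  Discrete integration by parts. Each edge occurs as two arcs, with equal contributions.
\<close>

lemma arc_flow_Green:
  assumes "\<And>x y. adj \<Gamma> x y \<Longrightarrow> z x y = - \<sigma> x y * z y x"
  shows "(\<Sum>x\<in>UNIV. \<Sum>y | adj \<Gamma> x y. w x y * (z x y * (g x - \<sigma> x y * g y)))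
       = 2 * (\<Sum>x\<in>UNIV. g x * (\<Sum>y | adj \<Gamma> x y. w x y * z x y))"
proof -
  have "(\<Sum>x\<in>UNIV. \<Sum>y | adj \<Gamma> x y. w x y * (z x y * (\<sigma> x y * g y)))
      = (\<Sum>x\<in>UNIV. \<Sum>y | adj \<Gamma> x y. w y x * (z y x * (\<sigma> y x * g x)))"
    by (rule arc_sum_swap)
  also have "\<dots> = (\<Sum>x\<in>UNIV. \<Sum>y | adj \<Gamma> x y. - (w x y * (z x y * g x)))"
  proof (intro sum.cong refl)
    fix x y assume "y \<in> {y. adj \<Gamma> x y}"
    then have "adj \<Gamma> x y" by simp
    then have "z y x * \<sigma> y x = - z x y"
      using assms[of x y] by (simp add: \<sigma>_sym[of y x])
    then show "w y x * (z y x * (\<sigma> y x * g x)) = - (w x y * (z x y * g x))"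
      by (simp add: w_sym[of y x] flip: mult.assoc)
  qed
  finally show ?thesis
    by (simp add: right_diff_distrib sum_subtractf sum_negf sum_distrib_left mult.left_commute mult.commute)
qed

lemma energy_nonneg: "energy f \<ge> 0"
  unfolding energy_def using w_pos by (fastforce intro!: mult_nonneg_nonneg sum_nonneg simp: less_imp_le)

lemma energy_eq_0_iff: "energy f = 0 \<longleftrightarrow> (\<forall>x y. adj \<Gamma> x y \<longrightarrow> f $ x = \<sigma> x y * f $ y)"
proof -
  have nn: "w x y * \<bar>f $ x - \<sigma> x y * f $ y\<bar> \<ge> 0" if "adj \<Gamma> x y" for x y
    using w_pos[OF that] by simp
  have "energy f = 0 \<longleftrightarrow> (\<forall>x. (\<Sum>y | adj \<Gamma> x y. w x y * \<bar>f $ x - \<sigma> x y * f $ y\<bar>) = 0)"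
    unfolding energy_def using nn by (subst mult_eq_0_iff, subst sum_nonneg_eq_0_iff) (auto intro!: sum_nonneg)
  also have "\<dots> \<longleftrightarrow> (\<forall>x y. adj \<Gamma> x y \<longrightarrow> w x y * \<bar>f $ x - \<sigma> x y * f $ y\<bar> = 0)"
    using nn by (subst sum_nonneg_eq_0_iff) auto
  also have "\<dots> \<longleftrightarrow> (\<forall>x y. adj \<Gamma> x y \<longrightarrow> f $ x = \<sigma> x y * f $ y)"
    using w_pos by fastforce
  finally show ?thesis .
qed

lemma energy_scaleR: "energy (c *\<^sub>R f) = \<bar>c\<bar> * energy f"
proof -
  have "\<bar>c * f $ x - \<sigma> x y * (c * f $ y)\<bar> = \<bar>c\<bar> * \<bar>f $ x - \<sigma> x y * f $ y\<bar>" for x y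
    by (simp add: algebra_simps flip: abs_mult)
  then show ?thesis by (simp add: energy_def sum_distrib_left mult.left_commute)
qed

text \<open>
  A function of zero energy satisfies \<open>h x = \<sigma> x y * h y\<close> along each edge, so it drops out of all the
  differences.
\<close>

lemma energy_add_kernel: "energy h = 0 \<Longrightarrow> energy (h + f) = energy f"
  unfolding energy_eq_0_iff unfolding energy_def by (auto simp: algebra_simps intro!: sum.cong)

lemma energy_add_le: "energy (f + g) \<le> energy f + energy g"
proof -
  have "w x y * \<bar>(f + g) $ x - \<sigma> x y * (f + g) $ y\<bar>
      \<le> w x y * \<bar>f $ x - \<sigma> x y * f $ y\<bar> + w x y * \<bar>g $ x - \<sigma> x y * g $ y\<bar>" if "adj \<Gamma> x y" for x y
  proof -
    have "\<bar>(f + g) $ x - \<sigma> x y * (f + g) $ y\<bar> \<le> \<bar>f $ x - \<sigma> x y * f $ y\<bar> + \<bar>g $ x - \<sigma> x y * g $ y\<bar>"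
      using abs_triangle_ineq[of "f $ x - \<sigma> x y * f $ y" "g $ x - \<sigma> x y * g $ y"] by (simp add: algebra_simps)
    then show ?thesis using w_pos[OF that] by (simp flip: distrib_left)
  qed
  then have "(\<Sum>x\<in>UNIV. \<Sum>y | adj \<Gamma> x y. w x y * \<bar>(f + g) $ x - \<sigma> x y * (f + g) $ y\<bar>)
     \<le> (\<Sum>x\<in>UNIV. \<Sum>y | adj \<Gamma> x y. w x y * \<bar>f $ x - \<sigma> x y * f $ y\<bar> + w x y * \<bar>g $ x - \<sigma> x y * g $ y\<bar>)"
    by (intro sum_mono) auto
  then show ?thesis by (simp add: energy_def sum.distrib)
qed

lemma energy_sum_le: "finite I \<Longrightarrow> energy (\<Sum>i\<in>I. c i *\<^sub>R \<psi> i) \<le> (\<Sum>i\<in>I. \<bar>c i\<bar> * energy (\<psi> i))"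
proof (induction I rule: finite_induct)
  case empty
  then show ?case by (simp add: energy_def)
next
  case (insert i I)
  then show ?case
    using energy_add_le[of "c i *\<^sub>R \<psi> i" "\<Sum>i\<in>I. c i *\<^sub>R \<psi> i"] by (simp add: energy_scaleR)
qed

lemma continuous_on_energy: "continuous_on X energy"
  unfolding energy_def[abs_def] by (intro continuous_intros)

lemma mass_nonneg: "mass f \<ge> 0"
  unfolding mass_def using \<mu>_pos by (intro sum_nonneg) (simp add: less_imp_le)

lemma mass_eq_0_iff: "mass f = 0 \<longleftrightarrow> f = 0"
proof -
  have "mass f = 0 \<longleftrightarrow> (\<forall>x. \<mu> x * \<bar>f $ x\<bar> = 0)"
    unfolding mass_def using \<mu>_pos by (subst sum_nonneg_eq_0_iff) (auto simp: less_imp_le)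
  then show ?thesis using \<mu>_pos by (simp add: vec_eq_iff less_imp_neq[OF \<mu>_pos, symmetric])
qed

lemma mass_pos: "f \<noteq> 0 \<Longrightarrow> mass f > 0"
  using mass_nonneg[of f] mass_eq_0_iff[of f] by linarith

lemma mass_scaleR: "mass (c *\<^sub>R f) = \<bar>c\<bar> * mass f"
  by (simp add: mass_def sum_distrib_left abs_mult mult.left_commute)

lemma continuous_on_mass: "continuous_on X mass"
  unfolding mass_def[abs_def] by (intro continuous_intros)

lemma mass_sum_disjoint:
  assumes "finite I"
    and disj: "\<And>i j x. i \<in> I \<Longrightarrow> j \<in> I \<Longrightarrow> \<psi> i $ x \<noteq> 0 \<Longrightarrow> \<psi> j $ x \<noteq> 0 \<Longrightarrow> i = j"
  shows "mass (\<Sum>i\<in>I. c i *\<^sub>R \<psi> i) = (\<Sum>i\<in>I. \<bar>c i\<bar> * mass (\<psi> i))"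
proof -
  have "\<bar>\<Sum>i\<in>I. c i * \<psi> i $ x\<bar> = (\<Sum>i\<in>I. \<bar>c i\<bar> * \<bar>\<psi> i $ x\<bar>)" for x
  proof (cases "\<exists>i\<in>I. \<psi> i $ x \<noteq> 0")
    case True
    then obtain i where i: "i \<in> I" "\<psi> i $ x \<noteq> 0" by blast
    then have "\<psi> j $ x = 0" if "j \<in> I - {i}" for j using disj[of i j x] that by blast
    then have "(\<Sum>i\<in>I. c i * \<psi> i $ x) = c i * \<psi> i $ x" "(\<Sum>i\<in>I. \<bar>c i\<bar> * \<bar>\<psi> i $ x\<bar>) = \<bar>c i\<bar> * \<bar>\<psi> i $ x\<bar>"
      using \<open>finite I\<close> i by (simp_all add: sum.remove[of I i])
    then show ?thesis by (simp add: abs_mult)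
  qed simp
  then have "mass (\<Sum>i\<in>I. c i *\<^sub>R \<psi> i) = (\<Sum>x\<in>UNIV. \<Sum>i\<in>I. \<bar>c i\<bar> * (\<mu> x * \<bar>\<psi> i $ x\<bar>))"
    by (simp add: mass_def sum_distrib_left mult.left_commute)
  also have "\<dots> = (\<Sum>i\<in>I. \<bar>c i\<bar> * mass (\<psi> i))"
    by (subst sum.swap) (simp add: mass_def sum_distrib_left)
  finally show ?thesis .
qed

lemma compact_unit_sphere1: "compact (unit_sphere1 \<Gamma>)"
proof -
  have "closed (mass -` {1})"
    using continuous_on_mass[of UNIV] by (intro continuous_closed_vimage) (auto simp: continuous_on_eq_continuous_at)
  moreover have "mass -` {1} = unit_sphere1 \<Gamma>" by (auto simp: unit_sphere1_eq)
  moreover have "bounded (unit_sphere1 \<Gamma>)"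
  proof -
    have "norm f \<le> (\<Sum>x\<in>UNIV. 1 / \<mu> x)" if "mass f = 1" for f
    proof -
      have "\<bar>f $ x\<bar> \<le> 1 / \<mu> x" for x
      proof -
        have "\<mu> x * \<bar>f $ x\<bar> \<le> mass f"
          unfolding mass_def using \<mu>_pos by (intro member_le_sum) (auto simp: less_imp_le)
        then show ?thesis using that \<mu>_pos[of x] by (simp add: field_simps)
      qed
      then have "(\<Sum>x\<in>UNIV. \<bar>f $ x\<bar>) \<le> (\<Sum>x\<in>UNIV. 1 / \<mu> x)" by (rule sum_mono)
      then show ?thesis using norm_le_l1_cart[of f] by linarith
    qed
    then show ?thesis unfolding bounded_iff unit_sphere1_eq by blast
  qed
  ultimately show ?thesis by (simp add: compact_eq_bounded_closed)
qed

lemma rayleigh1_on_sphere: "f \<in> unit_sphere1 \<Gamma> \<Longrightarrow> rayleigh1 \<Gamma> f = energy f"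
  by (simp add: rayleigh1_eq unit_sphere1_eq)

lemma bdd_above_rayleigh1: "S \<subseteq> unit_sphere1 \<Gamma> \<Longrightarrow> bdd_above (rayleigh1 \<Gamma> ` S)"
proof -
  assume S: "S \<subseteq> unit_sphere1 \<Gamma>"
  have "compact (energy ` unit_sphere1 \<Gamma>)"
    by (intro compact_continuous_image continuous_on_energy compact_unit_sphere1)
  then have "bdd_above (energy ` unit_sphere1 \<Gamma>)"
    by (intro bounded_imp_bdd_above compact_imp_bounded)
  moreover have "rayleigh1 \<Gamma> ` S \<subseteq> energy ` unit_sphere1 \<Gamma>"
    using S rayleigh1_on_sphere by force
  ultimately show ?thesis by (rule bdd_above_mono)
qed

lemma genus_family_nonempty: "S \<in> genus_family \<Gamma> k \<Longrightarrow> k \<ge> 1 \<Longrightarrow> S \<noteq> {}"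
  by (auto simp: genus_family_def genus_def zero_enat_def)

lemma genus_family_antimono: "i \<le> k \<Longrightarrow> genus_family \<Gamma> k \<subseteq> genus_family \<Gamma> i"
  by (auto simp: genus_family_def intro: order_trans[of "enat i" "enat k"])

lemma SUP_rayleigh1_nonneg:
  assumes "S \<in> genus_family \<Gamma> k" "k \<ge> 1"
  shows "(SUP f\<in>S. rayleigh1 \<Gamma> f) \<ge> 0"
proof -
  obtain f where "f \<in> S" using genus_family_nonempty[OF assms] by blast
  have "0 \<le> rayleigh1 \<Gamma> f" by (simp add: rayleigh1_eq energy_nonneg mass_nonneg)
  also have "\<dots> \<le> (SUP f\<in>S. rayleigh1 \<Gamma> f)"
    using assms \<open>f \<in> S\<close> by (intro cSUP_upper bdd_above_rayleigh1) (auto simp: genus_family_def)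
  finally show ?thesis .
qed

lemma bdd_below_SUP_rayleigh1:
  "k \<ge> 1 \<Longrightarrow> bdd_below ((\<lambda>S. SUP f\<in>S. rayleigh1 \<Gamma> f) ` genus_family \<Gamma> k)"
  using SUP_rayleigh1_nonneg by (auto intro!: bdd_belowI2)

lemma var_eigenvalue_le:
  assumes "S \<in> genus_family \<Gamma> k" "k \<ge> 1" "\<And>f. f \<in> S \<Longrightarrow> energy f \<le> c"
  shows "var_eigenvalue \<Gamma> k \<le> c"
proof -
  have "var_eigenvalue \<Gamma> k \<le> (SUP f\<in>S. rayleigh1 \<Gamma> f)"
    unfolding var_eigenvalue_def by (intro cINF_lower bdd_below_SUP_rayleigh1 assms)
  also have "\<dots> \<le> c"
  proof (rule cSUP_least)
    show "S \<noteq> {}" using genus_family_nonempty assms by blast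
    fix f assume "f \<in> S"
    moreover from this have "f \<in> unit_sphere1 \<Gamma>" using assms by (auto simp: genus_family_def)
    ultimately show "rayleigh1 \<Gamma> f \<le> c" using assms rayleigh1_on_sphere by simp
  qed
  finally show ?thesis .
qed

lemma var_eigenvalue_ge:
  assumes "genus_family \<Gamma> k \<noteq> {}" "\<And>S. S \<in> genus_family \<Gamma> k \<Longrightarrow> \<exists>f\<in>S. energy f \<ge> c"
  shows "var_eigenvalue \<Gamma> k \<ge> c"
  unfolding var_eigenvalue_def
proof (rule cINF_greatest[OF assms(1)])
  fix S assume S: "S \<in> genus_family \<Gamma> k"
  then obtain f where f: "f \<in> S" "energy f \<ge> c" using assms by blast
  have "f \<in> unit_sphere1 \<Gamma>" using f S by (auto simp: genus_family_def)
  then have "c \<le> rayleigh1 \<Gamma> f" using f rayleigh1_on_sphere by simp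
  also have "\<dots> \<le> (SUP f\<in>S. rayleigh1 \<Gamma> f)"
    using S f by (intro cSUP_upper bdd_above_rayleigh1) (auto simp: genus_family_def)
  finally show "c \<le> (SUP f\<in>S. rayleigh1 \<Gamma> f)" .
qed

lemma var_eigenvalue_mono:
  assumes "1 \<le> i" "i \<le> k" "genus_family \<Gamma> k \<noteq> {}"
  shows "var_eigenvalue \<Gamma> i \<le> var_eigenvalue \<Gamma> k"
  unfolding var_eigenvalue_def
  using assms by (intro cINF_superset_mono bdd_below_SUP_rayleigh1 genus_family_antimono) auto

lemma var_eigenvalue_nonneg:
  assumes "1 \<le> k" "genus_family \<Gamma> k \<noteq> {}"
  shows "var_eigenvalue \<Gamma> k \<ge> 0"
  unfolding var_eigenvalue_def
  using assms SUP_rayleigh1_nonneg by (intro cINF_greatest) auto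

section \<open>Genus of the unit sphere of a subspace\<close>

text \<open>
  Radial projection onto the unit sphere of the mass norm identifies the Euclidean sphere of dimension
  \<open>dim W - 1\<close> with the sphere of \<open>W\<close>, equivariantly; an odd map to the punctured \<open>k\<close>-dimensional space would
  then contradict the Borsuk--Ulam theorem.
\<close>

lemma no_odd_map_from_subspace_sphere:
  assumes W: "subspace W" and k: "0 < k" "k < dim W"
  shows "\<not> odd_map_to_punctured (W \<inter> unit_sphere1 \<Gamma>) k"
proof
  let ?S = "W \<inter> unit_sphere1 \<Gamma>" and ?m = "dim W"
  assume "odd_map_to_punctured ?S k"
  then obtain \<phi> where
    "continuous_map (top_of_set ?S) (subtopology (Euclidean_space k) (- {\<lambda>_. 0})) \<phi>"
    and odd: "\<And>y i. y \<in> ?S \<Longrightarrow> \<phi> (- y) i = - \<phi> y i"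
    unfolding odd_map_to_punctured_def by blast
  then have cont: "continuous_on ?S \<phi>"
    and van: "\<And>y i. y \<in> ?S \<Longrightarrow> i \<ge> k \<Longrightarrow> \<phi> y i = 0"
    and nz: "\<And>y. y \<in> ?S \<Longrightarrow> \<phi> y \<noteq> (\<lambda>_. 0)"
    by (auto simp: Euclidean_space_def euclidean_product_topology continuous_map_in_subtopology
        image_subset_iff Pi_iff)
  obtain B where B: "B \<subseteq> W" "independent B" "W \<subseteq> span B" "card B = ?m"
    using basis_exists[of W] by blast
  have "finite B" using B(2) by (rule independent_imp_finite)
  then obtain b where b: "bij_betw b {0..<?m} B"
    using ex_bij_betw_nat_finite B(4) by metis
  define L where "L x = (\<Sum>i<?m. x i *\<^sub>R b i)" for x :: "nat \<Rightarrow> real"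
  have LW: "L x \<in> W" for x
    unfolding L_def using b B(1) by (intro subspace_sum[OF W] subspace_scale[OF W]) (auto simp: bij_betw_def)
  have Lnz: "L x \<noteq> 0" if x: "x \<in> seq_sphere (?m - 1)" for x
  proof
    assume "L x = 0"
    let ?u = "\<lambda>v. x (the_inv_into {0..<?m} b v)"
    have "(\<Sum>v\<in>B. ?u v *\<^sub>R v) = (\<Sum>i\<in>{0..<?m}. ?u (b i) *\<^sub>R b i)"
      using sum.reindex_bij_betw[OF b, of "\<lambda>v. ?u v *\<^sub>R v"] by simp
    also have "\<dots> = L x"
      unfolding L_def atLeast0LessThan[symmetric]
      using b by (intro sum.cong) (auto simp: bij_betw_def the_inv_into_f_f)
    finally have sum0: "(\<Sum>v\<in>B. ?u v *\<^sub>R v) = 0" using \<open>L x = 0\<close> by simp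
    have u0: "?u v = 0" if "v \<in> B" for v
    proof (rule ccontr)
      assume "?u v \<noteq> 0"
      with sum0 that have "dependent B"
        unfolding dependent_finite[OF \<open>finite B\<close>] by (intro exI[of _ ?u] conjI bexI[of _ v])
      then show False using B(2) by contradiction
    qed
    have "x i = 0" if "i < ?m" for i
    proof -
      have "b i \<in> B" using b that by (auto simp: bij_betw_def)
      moreover have "the_inv_into {0..<?m} b (b i) = i"
        using b that by (intro the_inv_into_f_f) (auto simp: bij_betw_def)
      ultimately show ?thesis using u0 by metis
    qed
    then have "(\<Sum>i\<le>?m - 1. (x i)\<^sup>2) = 0" using k by (intro sum.neutral) auto
    then show False using x by simp
  qed
  define P where "P x = (1 / mass (L x)) *\<^sub>R L x" for x
  have PS: "P x \<in> ?S" if "x \<in> seq_sphere (?m - 1)" for x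
    using mass_pos[OF Lnz[OF that]] LW[of x]
    by (auto simp: P_def subspace_scale[OF W] unit_sphere1_eq mass_scaleR)
  have Podd: "P (\<lambda>i. - x i) = - P x" for x
  proof -
    have "L (\<lambda>i. - x i) = - L x" by (simp add: L_def sum_negf)
    moreover have "mass (- L x) = mass (L x)" using mass_scaleR[of "-1" "L x"] by simp
    ultimately show ?thesis by (simp add: P_def)
  qed
  have Lcont: "continuous_on X L" for X
    unfolding L_def
    by (intro continuous_intros continuous_on_subset[OF continuous_on_product_coordinates]) auto
  have "continuous_on (seq_sphere (?m - 1)) (\<lambda>x. mass (L x))"
    by (rule continuous_on_compose2[OF continuous_on_mass[of UNIV] Lcont]) auto
  moreover have "\<forall>x\<in>seq_sphere (?m - 1). mass (L x) \<noteq> 0"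
    using Lnz mass_eq_0_iff by blast
  ultimately have Pcont: "continuous_on (seq_sphere (?m - 1)) P"
    unfolding P_def by (intro continuous_on_scaleR continuous_on_divide continuous_on_const Lcont)
  have cont\<phi>P: "continuous_on (seq_sphere (?m - 1)) (\<lambda>x. \<phi> (P x))"
    by (rule continuous_on_compose2[OF cont Pcont]) (use PS in blast)
  have \<phi>P: "\<exists>i\<le>k - 1. \<phi> (P x) i \<noteq> 0" if x: "x \<in> seq_sphere (?m - 1)" for x
  proof -
    obtain i where "\<phi> (P x) i \<noteq> 0" using nz[OF PS[OF x]] by auto
    moreover from this have "i < k" using van[OF PS[OF x], of i] by force
    ultimately show ?thesis using k by (intro exI[of _ i]) auto
  qed
  define f where "f x = normalize_seq (k - 1) (\<phi> (P x))" for x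
  have "\<exists>x\<in>seq_sphere (?m - 1). \<exists>i. f (\<lambda>j. - x j) i \<noteq> - f x i"
  proof (rule Borsuk_Ulam)
    have "?m \<le> DIM(real^'v)" by (rule dim_subset_UNIV)
    then show "?m - 1 < DIM(real^'v)" using k by linarith
    show "k - 1 < ?m - 1" using k by simp
    show "continuous_on (seq_sphere (?m - 1)) f"
      unfolding f_def using \<phi>P
      by (intro continuous_on_normalize_seq continuous_on_product_then_coordinatewise[OF cont\<phi>P])
    show "f \<in> seq_sphere (?m - 1) \<rightarrow> seq_sphere (k - 1)"
      unfolding f_def by (rule Pi_I) (rule normalize_seq_in_sphere[OF \<phi>P])
  qed
  moreover have "f (\<lambda>j. - x j) = (\<lambda>i. - f x i)" if x: "x \<in> seq_sphere (?m - 1)" for x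
  proof -
    have "\<phi> (- P x) = (\<lambda>i. - \<phi> (P x) i)" using odd[OF PS[OF x]] by auto
    then show ?thesis by (simp add: f_def Podd normalize_seq_uminus)
  qed
  ultimately show False by auto
qed

lemma subspace_sphere_in_genus_family:
  assumes W: "subspace W"
  shows "W \<inter> unit_sphere1 \<Gamma> \<in> genus_family \<Gamma> (dim W)"
proof -
  let ?S = "W \<inter> unit_sphere1 \<Gamma>"
  have "compact ?S"
    using compact_unit_sphere1 closed_subspace[OF W] by (simp add: closed_Int_compact)
  moreover have neg: "- f \<in> ?S" if "f \<in> ?S" for f
    using that mass_scaleR[of "-1" f] by (auto simp: unit_sphere1_eq subspace_neg[OF W])
  then have "uminus ` ?S = ?S"
    by (auto simp: image_iff intro!: bexI[of _ "- f" for f])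
  moreover have "genus ?S \<ge> enat (dim W)"
  proof (cases "dim W = 0")
    case True
    then have "enat (dim W) = 0" by (simp only: zero_enat_def)
    then show ?thesis by (simp only: zero_le)
  next
    case False
    then obtain v where v: "v \<in> W" "v \<noteq> 0" using dim_eq_0[of W] by auto
    then have "(1 / mass v) *\<^sub>R v \<in> ?S"
      using mass_pos[of v] by (auto simp: unit_sphere1_eq mass_scaleR subspace_scale[OF W])
    moreover have "enat (dim W) \<le> enat k" if "k > 0" "odd_map_to_punctured ?S k" for k
      using no_odd_map_from_subspace_sphere[OF W that(1)] that(2) by (simp add: not_less[symmetric]) blast
    ultimately show ?thesis unfolding genus_def by (auto intro!: Inf_greatest)
  qed
  ultimately show ?thesis by (simp add: genus_family_def)
qed

section \<open>Eigenfunctions from minimal balanced vectors\<close>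

text \<open>
  The energy is the support function of the set of divergences of edge flows with values in \<open>[-1, 1]\<close> that
  are antisymmetric up to the signature. This set is compact and convex, so a separating hyperplane shows that it contains every vector
  \<open>v\<close> dominated by the energy.
\<close>

lemma energy_dual_flow:
  assumes le: "\<And>h. v \<bullet> h \<le> energy h"
  obtains z where "\<And>x y. \<bar>z x y\<bar> \<le> 1" "\<And>x y. adj \<Gamma> x y \<Longrightarrow> z x y = - \<sigma> x y * z y x"
    "\<And>x. (\<Sum>y | adj \<Gamma> x y. w x y * z x y) = v $ x"
proof -
  define Z :: "(real^'v^'v) set" where
    "Z = {z. \<forall>x y. \<bar>z $ x $ y\<bar> \<le> 1 \<and> (adj \<Gamma> x y \<longrightarrow> z $ x $ y = - \<sigma> x y * z $ y $ x)}"
  define T :: "real^'v^'v \<Rightarrow> real^'v" where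
    "T z = (\<chi> x. \<Sum>y | adj \<Gamma> x y. w x y * z $ x $ y)" for z
  have "linear T"
    by (rule linearI) (simp_all add: T_def vec_eq_iff distrib_left sum.distrib sum_distrib_left mult.left_commute)
  have "convex Z"
    unfolding convex_def
  proof (intro ballI allI impI)
    fix z z' :: "real^'v^'v" and u t :: real
    assume z: "z \<in> Z" "z' \<in> Z" and u: "0 \<le> u" "0 \<le> t" "u + t = 1"
    have "\<bar>u * z $ x $ y + t * z' $ x $ y\<bar> \<le> 1" for x y
    proof -
      have "\<bar>u * z $ x $ y + t * z' $ x $ y\<bar> \<le> u * \<bar>z $ x $ y\<bar> + t * \<bar>z' $ x $ y\<bar>"
        using abs_triangle_ineq[of "u * z $ x $ y" "t * z' $ x $ y"] u by (simp add: abs_mult)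
      also have "\<dots> \<le> u * 1 + t * 1"
        using z u by (intro add_mono mult_left_mono) (auto simp: Z_def)
      finally show ?thesis using u by simp
    qed
    moreover have "u * z $ x $ y + t * z' $ x $ y = - \<sigma> x y * (u * z $ y $ x + t * z' $ y $ x)"
      if "adj \<Gamma> x y" for x y
    proof -
      have "z $ x $ y = - \<sigma> x y * z $ y $ x" "z' $ x $ y = - \<sigma> x y * z' $ y $ x"
        using z that by (auto simp: Z_def)
      then show ?thesis by (simp only: algebra_simps)
    qed
    ultimately show "u *\<^sub>R z + t *\<^sub>R z' \<in> Z" by (simp add: Z_def)
  qed
  moreover have "compact Z"
    unfolding compact_eq_bounded_closed
  proof
    have "norm z \<le> (\<Sum>x\<in>(UNIV :: 'v set). \<Sum>y\<in>(UNIV :: 'v set). 1)" if "z \<in> Z" for z :: "real^'v^'v"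
    proof -
      have "norm (z $ x) \<le> (\<Sum>y\<in>(UNIV :: 'v set). 1)" for x :: 'v
      proof -
        have "norm (z $ x) \<le> (\<Sum>y\<in>UNIV. \<bar>z $ x $ y\<bar>)" by (rule norm_le_l1_cart)
        also have "\<dots> \<le> (\<Sum>y\<in>(UNIV :: 'v set). 1)" using that by (intro sum_mono) (auto simp: Z_def)
        finally show ?thesis .
      qed
      then show ?thesis
        unfolding norm_vec_def[of z]
        by (intro order_trans[OF L2_set_le_sum sum_mono]) auto
    qed
    then show "bounded Z" unfolding bounded_iff by blast
    have "Z = (\<Inter>x. \<Inter>y. {z. \<bar>z $ x $ y\<bar> \<le> 1} \<inter> {z. adj \<Gamma> x y \<longrightarrow> z $ x $ y = - \<sigma> x y * z $ y $ x})"
      by (auto simp: Z_def)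
    moreover have "closed \<dots>"
      by (intro closed_INT ballI closed_Int closed_Collect_le closed_Collect_imp closed_Collect_eq continuous_intros) auto
    ultimately show "closed Z" by simp
  qed
  ultimately have cT: "convex (T ` Z)" "compact (T ` Z)"
    using \<open>linear T\<close> linear_continuous_on[of T] linear_conv_bounded_linear[of T]
    by (auto intro: convex_linear_image compact_continuous_image)
  have "v \<in> T ` Z"
  proof (rule ccontr)
    assume "v \<notin> T ` Z"
    then obtain a b where ab: "a \<bullet> v < b" "\<And>u. u \<in> T ` Z \<Longrightarrow> a \<bullet> u > b"
      using separating_hyperplane_closed_point[OF cT(1) compact_imp_closed[OF cT(2)]] by blast
    define h where "h = - a"
    \<comment> \<open>The flow that attains the maximum in direction \<open>h\<close>.\<close>
    define z where "z = (\<chi> x y. sgn (h $ x - \<sigma> x y * h $ y))"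
    have anti: "z $ x $ y = - \<sigma> x y * z $ y $ x" if "adj \<Gamma> x y" for x y
    proof -
      have "h $ x - \<sigma> x y * h $ y = - \<sigma> x y * (h $ y - \<sigma> y x * h $ x)"
        using \<sigma>_square[OF that] by (simp add: \<sigma>_sym[of y x] right_diff_distrib mult.assoc[symmetric])
      then have "z $ x $ y = sgn (- \<sigma> x y) * z $ y $ x"
        by (simp only: z_def vec_lambda_beta sgn_mult)
      moreover have "sgn (- \<sigma> x y) = - \<sigma> x y" using \<sigma>_cases[OF that] by auto
      ultimately show ?thesis by simp
    qed
    have "z \<in> Z" using anti by (auto simp: Z_def) (simp add: z_def abs_sgn_eq)
    have "2 * (h \<bullet> T z) = (\<Sum>x\<in>UNIV. \<Sum>y | adj \<Gamma> x y. w x y * (z $ x $ y * (h $ x - \<sigma> x y * h $ y)))"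
      using arc_flow_Green[of "\<lambda>x y. z $ x $ y" "\<lambda>x. h $ x"] anti by (simp add: T_def inner_vec_def)
    also have "\<dots> = 2 * energy h"
      by (simp add: energy_def z_def abs_sgn mult.commute)
    finally have "h \<bullet> T z = energy h" by simp
    moreover have "h \<bullet> T z < h \<bullet> v" using ab(1) ab(2)[of "T z"] \<open>z \<in> Z\<close> by (simp add: h_def)
    ultimately show False using le[of h] by (simp add: inner_commute)
  qed
  then obtain z where "z \<in> Z" "v = T z" by blast
  then show thesis by (intro that[of "\<lambda>x y. z $ x $ y"]) (auto simp: Z_def T_def)
qed

definition pairing :: "real ^ 'v \<Rightarrow> real ^ 'v \<Rightarrow> real" where
  "pairing s h = (\<Sum>x\<in>UNIV. \<mu> x * (s $ x * h $ x))"

lemma pairing_add: "pairing s (g + h) = pairing s g + pairing s h"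
  by (simp add: pairing_def distrib_left sum.distrib)

lemma pairing_scaleR: "pairing s (c *\<^sub>R h) = c * pairing s h"
  by (simp add: pairing_def sum_distrib_left mult.left_commute)

lemma abs_pairing_le_mass:
  assumes "\<And>x. \<bar>s $ x\<bar> \<le> 1"
  shows "\<bar>pairing s h\<bar> \<le> mass h"
proof -
  have "\<bar>pairing s h\<bar> \<le> (\<Sum>x\<in>UNIV. \<bar>\<mu> x * (s $ x * h $ x)\<bar>)"
    unfolding pairing_def by (rule sum_abs)
  also have "\<dots> \<le> mass h"
    unfolding mass_def
  proof (rule sum_mono)
    fix x
    have "\<bar>s $ x\<bar> * \<bar>h $ x\<bar> \<le> 1 * \<bar>h $ x\<bar>" using assms by (intro mult_right_mono) auto
    then show "\<bar>\<mu> x * (s $ x * h $ x)\<bar> \<le> \<mu> x * \<bar>h $ x\<bar>"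
      using \<mu>_pos[of x] by (simp add: abs_mult)
  qed
  finally show ?thesis .
qed

text \<open>
  Unit vectors \<open>f\<close> that are balanced against \<open>K\<close>, together with a witness \<open>s\<close>: a selection of \<open>Sgn f\<close> whose
  weighted pairing with \<open>K\<close> vanishes. For \<open>K\<close> spanned by a single function with entries \<open>-1\<close> and \<open>1\<close> this says
  that, up to these signs, 0 is a weighted median of \<open>f\<close>. Keeping \<open>s\<close> in the pair makes the set compact.
\<close>

definition calibrated_pairs :: "(real ^ 'v) set \<Rightarrow> ((real ^ 'v) \<times> (real ^ 'v)) set" where
  "calibrated_pairs K = {(f, s). f \<in> unit_sphere1 \<Gamma> \<and> (\<forall>x. \<bar>s $ x\<bar> \<le> 1 \<and> s $ x * f $ x = \<bar>f $ x\<bar>) \<and>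
     (\<forall>\<psi>\<in>K. pairing s \<psi> = 0)}"

lemma pairing_calibrated: "(f, s) \<in> calibrated_pairs K \<Longrightarrow> pairing s f = 1"
  by (simp add: calibrated_pairs_def pairing_def unit_sphere1_eq mass_def)

lemma compact_calibrated_pairs: "compact (calibrated_pairs K)"
proof -
  let ?box = "cbox (- 1) 1 :: (real^'v) set"
  have "calibrated_pairs K = (unit_sphere1 \<Gamma> \<times> ?box)
      \<inter> ((\<Inter>x. {p. snd p $ x * fst p $ x = \<bar>fst p $ x\<bar>}) \<inter> (\<Inter>\<psi>\<in>K. {p. pairing (snd p) \<psi> = 0}))"
    by (auto simp: calibrated_pairs_def mem_box_cart abs_le_iff minus_le_iff)
  moreover have "compact \<dots>"
    unfolding pairing_def
    by (intro compact_Int_closed compact_Times compact_unit_sphere1 compact_cbox closed_Int closed_INT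
        ballI closed_Collect_eq continuous_intros)
  ultimately show ?thesis by simp
qed

text \<open>
  The sign function is not continuous, but \<open>t / (\<bar>t\<bar> + \<epsilon>)\<close> is, and it is odd. Paired with a basis of \<open>K\<close> it gives
  an odd continuous map from \<open>S\<close> into the space of dimension \<open>dim K\<close>, which must vanish somewhere by the
  genus of \<open>S\<close>. As \<open>\<epsilon>\<close> tends to zero, the zeros accumulate at a vector of \<open>S\<close>, and their regularised signs
  at a witness for it.
\<close>

lemma genus_family_meets_calibrated:
  assumes K: "subspace K" and S: "S \<in> genus_family \<Gamma> (Suc (dim K))"
  obtains f s where "f \<in> S" "(f, s) \<in> calibrated_pairs K"
proof -
  let ?p = "dim K"
  have S': "compact S" "uminus ` S = S" "S \<subseteq> unit_sphere1 \<Gamma>" "enat (Suc ?p) \<le> genus S"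
    using S by (auto simp: genus_family_def)
  have "S \<noteq> {}" using genus_family_nonempty[OF S] by simp
  obtain B where B: "B \<subseteq> K" "independent B" "K \<subseteq> span B" "card B = ?p"
    using basis_exists[of K] by blast
  have "finite B" using B(2) by (rule independent_imp_finite)
  then obtain b where b: "bij_betw b {0..<?p} B"
    using ex_bij_betw_nat_finite B(4) by metis
  define g where "g n t = t / (\<bar>t\<bar> + inverse (Suc n))" for n and t :: real
  have den: "\<bar>t\<bar> + inverse (Suc n) > 0" for n :: nat and t :: real
    by (intro add_nonneg_pos) auto
  have gcont: "continuous_on X (\<lambda>f. g n (f $ x))" for X :: "(real^'v) set" and n x
    unfolding g_def by (intro continuous_intros) (use den in \<open>auto simp: less_imp_neq[symmetric]\<close>)
  have "\<exists>f\<in>S. \<forall>i<?p. pairing (\<chi> x. g n (f $ x)) (b i) = 0" for n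
  proof (cases "?p = 0")
    case True
    moreover obtain f where "f \<in> S" using \<open>S \<noteq> {}\<close> by blast
    ultimately show ?thesis by (intro bexI[of _ f]) (simp_all only: not_less_zero simp_thms)
  next
    case False
    show ?thesis
    proof (rule ccontr)
      assume no: "\<not> ?thesis"
      define \<phi> where "\<phi> = (\<lambda>f i. if i < ?p then pairing (\<chi> x. g n (f $ x)) (b i) else 0)"
      have "continuous_map (top_of_set S) (Euclidean_space ?p) \<phi>"
        unfolding \<phi>_def continuous_map_componentwise_Euclidean_space
        by (auto simp: pairing_def intro!: continuous_intros gcont)
      moreover have "\<phi> f \<noteq> (\<lambda>_. 0)" if "f \<in> S" for f
        using no that by (auto simp: \<phi>_def fun_eq_iff)
      ultimately have "continuous_map (top_of_set S) (subtopology (Euclidean_space ?p) (- {\<lambda>_. 0})) \<phi>"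
        by (auto simp: continuous_map_in_subtopology)
      moreover have "\<phi> (- f) i = - \<phi> f i" for f i
        by (simp add: \<phi>_def pairing_def g_def sum_negf)
      ultimately have "odd_map_to_punctured S ?p"
        unfolding odd_map_to_punctured_def by blast
      then have "genus S \<le> enat ?p"
        using \<open>S \<noteq> {}\<close> False by (auto simp: genus_def intro!: Inf_lower)
      then have "enat (Suc ?p) \<le> enat ?p" using S'(4) by (rule order_trans[rotated])
      then show False by simp
    qed
  qed
  then obtain F where F: "\<And>n. F n \<in> S" "\<And>n i. i < ?p \<Longrightarrow> pairing (\<chi> x. g n (F n $ x)) (b i) = 0"
    by metis
  define s where "s n = (\<chi> x. g n (F n $ x))" for n
  have g1: "\<bar>g n t\<bar> \<le> 1" for n t
    using den[of t n] by (simp add: g_def abs_div)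
  have gt: "\<bar>g n t * t - \<bar>t\<bar>\<bar> \<le> inverse (Suc n)" for n t
  proof -
    have "g n t * t - \<bar>t\<bar> = - (inverse (Suc n) * (\<bar>t\<bar> / (\<bar>t\<bar> + inverse (Suc n))))"
    proof -
      define d where "d = \<bar>t\<bar> + inverse (Suc n)"
      have "d > 0" using den[of t n] by (simp add: d_def)
      have "g n t * t - \<bar>t\<bar> = (t * t - \<bar>t\<bar> * d) / d"
      proof -
        have "g n t = t / d" by (simp only: g_def d_def)
        then show ?thesis using \<open>d > 0\<close> by (simp add: field_simps)
      qed
      also have "t * t - \<bar>t\<bar> * d = - (inverse (Suc n) * \<bar>t\<bar>)"
        by (simp add: d_def algebra_simps)
      finally show ?thesis by (simp add: d_def)
    qed
    moreover have "\<bar>\<bar>t\<bar> / (\<bar>t\<bar> + inverse (Suc n))\<bar> \<le> 1"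
      using den[of t n] by auto
    then have "\<bar>inverse (Suc n)\<bar> * \<bar>\<bar>t\<bar> / (\<bar>t\<bar> + inverse (Suc n))\<bar> \<le> \<bar>inverse (Suc n)\<bar>"
      by (rule mult_left_le) simp
    ultimately show ?thesis
      by (simp only: abs_minus_cancel abs_mult) simp
  qed
  have "(F n, s n) \<in> S \<times> cbox (- 1) 1" for n
    using F(1) g1 by (auto simp: s_def mem_box_cart abs_le_iff minus_le_iff)
  moreover have "compact (S \<times> (cbox (- 1) 1 :: (real^'v) set))"
    by (intro compact_Times S' compact_cbox)
  ultimately obtain l r where l: "l \<in> S \<times> cbox (- 1) 1" and r: "strict_mono r"
    and lim: "((\<lambda>n. (F n, s n)) \<circ> r) \<longlonglongrightarrow> l"
    unfolding compact_def by meson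
  obtain f t where ft: "l = (f, t)" by (cases l)
  have limF: "(\<lambda>n. F (r n)) \<longlonglongrightarrow> f" and lims: "(\<lambda>n. s (r n)) \<longlonglongrightarrow> t"
    using tendsto_fst[OF lim] tendsto_snd[OF lim] by (simp_all add: ft o_def)
  show thesis
  proof (rule that[of f t])
    show "f \<in> S" using l ft by simp
    have "f \<in> unit_sphere1 \<Gamma>" using l ft S' by auto
    moreover have "\<bar>t $ x\<bar> \<le> 1" for x
      using l ft by (auto simp: mem_box_cart abs_le_iff minus_le_iff)
    moreover have "t $ x * f $ x = \<bar>f $ x\<bar>" for x
    proof -
      have "(\<lambda>n. s (r n) $ x * F (r n) $ x - \<bar>F (r n) $ x\<bar>) \<longlonglongrightarrow> t $ x * f $ x - \<bar>f $ x\<bar>"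
        by (intro tendsto_intros limF lims)
      moreover have "(\<lambda>n. s (r n) $ x * F (r n) $ x - \<bar>F (r n) $ x\<bar>) \<longlonglongrightarrow> 0"
      proof (rule Lim_null_comparison)
        show "\<forall>\<^sub>F n in sequentially. norm (s (r n) $ x * F (r n) $ x - \<bar>F (r n) $ x\<bar>) \<le> inverse (Suc (r n))"
          using gt by (auto simp: s_def)
        show "(\<lambda>n. inverse (real (Suc (r n)))) \<longlonglongrightarrow> 0"
          using LIMSEQ_subseq_LIMSEQ[OF LIMSEQ_inverse_real_of_nat r] by (simp add: o_def)
      qed
      ultimately have "t $ x * f $ x - \<bar>f $ x\<bar> = 0" by (rule LIMSEQ_unique)
      then show ?thesis by simp
    qed
    moreover have "pairing t \<psi> = 0" if "\<psi> \<in> K" for \<psi>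
    proof -
      have zero: "pairing t (b i) = 0" if "i < ?p" for i
      proof -
        have "(\<lambda>n. pairing (s (r n)) (b i)) \<longlonglongrightarrow> pairing t (b i)"
          unfolding pairing_def by (intro tendsto_intros lims)
        moreover have "pairing (s (r n)) (b i) = 0" for n
          using F(2) that by (simp add: s_def)
        ultimately show ?thesis using LIMSEQ_unique[OF _ tendsto_const] by simp
      qed
      have "\<psi> \<in> span B" using that B(3) by blast
      then show ?thesis
      proof (induction rule: span_induct_alt)
        case base
        then show ?case by (simp add: pairing_def)
      next
        case (step c v y)
        then obtain i where "i < ?p" "v = b i" using b by (auto simp: bij_betw_def)
        then show ?case using zero step by (simp add: pairing_add pairing_scaleR)
      qed
    qed
    ultimately show "(f, t) \<in> calibrated_pairs K" by (simp add: calibrated_pairs_def)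
  qed
qed

text \<open>
  For \<open>h\<close> outside \<open>K\<close>, the sphere of the span of \<open>K\<close> and \<open>h\<close> has genus greater than \<open>dim K\<close> and hence contains a
  balanced vector \<open>g = \<psi> + c h\<close> with \<open>\<psi> \<in> K\<close>. Neither the energy nor the pairing with \<open>s\<close> sees \<open>\<psi>\<close>, so minimality
  gives \<open>E f \<le> \<bar>c\<bar> E h\<close>, while \<open>\<bar>c\<bar>\<close> times the pairing of \<open>s\<close> with \<open>h\<close> is at most the mass of \<open>g\<close>, that is, 1.
\<close>

lemma minimal_calibrated_pair_gradient:
  assumes K: "subspace K" and kernel: "\<And>\<psi>. \<psi> \<in> K \<Longrightarrow> energy \<psi> = 0"
    and fs: "(f, s) \<in> calibrated_pairs K"
    and min: "\<And>g t. (g, t) \<in> calibrated_pairs K \<Longrightarrow> energy f \<le> energy g"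
  shows "energy f * pairing s h \<le> energy h"
proof (cases "h \<in> K")
  case True
  then show ?thesis using fs energy_nonneg[of h] by (simp add: calibrated_pairs_def)
next
  case False
  let ?W = "span (insert h K)"
  have sK: "span K = K" using K by simp
  have "dim ?W = Suc (dim K)"
    unfolding dim_span dim_insert sK using False by simp
  then have "?W \<inter> unit_sphere1 \<Gamma> \<in> genus_family \<Gamma> (Suc (dim K))"
    using subspace_sphere_in_genus_family[of ?W] by simp
  then obtain g t where g: "g \<in> ?W" "mass g = 1" and gt: "(g, t) \<in> calibrated_pairs K"
    using genus_family_meets_calibrated[OF K] unit_sphere1_eq by blast
  obtain c where c: "g - c *\<^sub>R h \<in> K"
    using g(1) unfolding span_breakdown_eq sK by blast
  have "c \<noteq> 0"
  proof
    assume "c = 0"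
    then have "pairing t g = 0" using c gt by (simp add: calibrated_pairs_def)
    then show False using pairing_calibrated[OF gt] by simp
  qed
  have "energy g = \<bar>c\<bar> * energy h"
    using energy_add_kernel[OF kernel[OF c], of "c *\<^sub>R h"] by (simp add: energy_scaleR)
  moreover have "energy f \<le> energy g" using min[OF gt] .
  moreover have "pairing s g = c * pairing s h"
  proof -
    have "pairing s (g - c *\<^sub>R h) = 0" using fs c by (simp add: calibrated_pairs_def)
    then show ?thesis
      using pairing_add[of s "g - c *\<^sub>R h" "c *\<^sub>R h"] by (simp add: pairing_scaleR)
  qed
  moreover have "\<bar>pairing s g\<bar> \<le> 1"
    using abs_pairing_le_mass[of s g] fs g(2) by (auto simp: calibrated_pairs_def)
  ultimately have "\<bar>c\<bar> * (energy f * \<bar>pairing s h\<bar>) \<le> \<bar>c\<bar> * energy h"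
    using mult_left_mono[of "\<bar>c * pairing s h\<bar>" 1 "energy f"] energy_nonneg[of f]
    by (simp add: abs_mult mult.left_commute)
  then have "energy f * \<bar>pairing s h\<bar> \<le> energy h" using \<open>c \<noteq> 0\<close> by simp
  moreover have "energy f * pairing s h \<le> energy f * \<bar>pairing s h\<bar>"
    using energy_nonneg by (intro mult_left_mono) auto
  ultimately show ?thesis by linarith
qed

text \<open>
  The gradient inequality makes \<open>E f\<close> times the weighted \<open>s\<close> the divergence of a flow \<open>z\<close>. Equality at \<open>h = f\<close>
  leaves no slack on any edge, which forces \<open>z\<close> to be a selection of the signs of the differences of \<open>f\<close>.
\<close>

lemma eigenpair_of_calibrated_gradient:
  assumes fs: "(f, s) \<in> calibrated_pairs K"
    and grad: "\<And>h. energy f * pairing s h \<le> energy h"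
  shows "eigenpair \<Gamma> f (energy f)"
proof -
  define v where "v = (\<chi> x. energy f * (\<mu> x * s $ x))"
  have v: "v \<bullet> h = energy f * pairing s h" for h
    by (simp add: v_def pairing_def inner_vec_def sum_distrib_left mult.assoc)
  obtain z where z1: "\<And>x y. \<bar>z x y\<bar> \<le> 1"
    and anti: "\<And>x y. adj \<Gamma> x y \<Longrightarrow> z x y = - \<sigma> x y * z y x"
    and zv: "\<And>x. (\<Sum>y | adj \<Gamma> x y. w x y * z x y) = v $ x"
    using energy_dual_flow[of v] grad v by metis
  let ?d = "\<lambda>x y. f $ x - \<sigma> x y * f $ y"
  have "(\<Sum>x\<in>UNIV. \<Sum>y | adj \<Gamma> x y. w x y * (z x y * ?d x y)) = 2 * (f \<bullet> v)"
    using arc_flow_Green[of z "\<lambda>x. f $ x"] anti zv by (simp add: inner_vec_def)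
  also have "\<dots> = 2 * energy f"
    using v[of f] pairing_calibrated[OF fs] by (simp add: inner_commute)
  finally have zero: "(\<Sum>x\<in>UNIV. \<Sum>y | adj \<Gamma> x y. w x y * (\<bar>?d x y\<bar> - z x y * ?d x y)) = 0"
    by (simp add: energy_def right_diff_distrib sum_subtractf)
  have le: "z x y * ?d x y \<le> \<bar>?d x y\<bar>" for x y
  proof -
    have "z x y * ?d x y \<le> \<bar>z x y\<bar> * \<bar>?d x y\<bar>" by (simp flip: abs_mult)
    also have "\<dots> \<le> 1 * \<bar>?d x y\<bar>" using z1 by (intro mult_right_mono) auto
    finally show ?thesis by simp
  qed
  then have nn: "w x y * (\<bar>?d x y\<bar> - z x y * ?d x y) \<ge> 0" if "adj \<Gamma> x y" for x y
    using w_pos[OF that] by (intro mult_nonneg_nonneg) (auto simp: less_imp_le)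
  have "w x y * (\<bar>?d x y\<bar> - z x y * ?d x y) = 0" if a: "adj \<Gamma> x y" for x y
  proof -
    have "(\<Sum>y | adj \<Gamma> x y. w x y * (\<bar>?d x y\<bar> - z x y * ?d x y)) = 0"
      using zero nn by (subst (asm) sum_nonneg_eq_0_iff) (auto intro!: sum_nonneg)
    then show ?thesis
      using nn a by (subst (asm) sum_nonneg_eq_0_iff) auto
  qed
  then have "z x y \<in> Sgn (?d x y)" if "adj \<Gamma> x y" for x y
    using w_pos[OF that] z1 that by (fastforce simp: in_Sgn_iff)
  moreover have "s $ x \<in> Sgn (f $ x)" for x
    using fs by (simp add: in_Sgn_iff calibrated_pairs_def)
  moreover have "f \<noteq> 0"
    using fs mass_eq_0_iff[of f] by (auto simp: calibrated_pairs_def unit_sphere1_eq)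
  ultimately show ?thesis
    unfolding eigenpair_def using anti zv
    by (intro conjI exI[of _ z] exI[of _ "\<lambda>x. s $ x"]) (auto simp: v_def mult.assoc)
qed

proposition eigenpair_below_genus_family:
  assumes K: "subspace K" and kernel: "\<And>\<psi>. \<psi> \<in> K \<Longrightarrow> energy \<psi> = 0"
    and ne: "genus_family \<Gamma> (Suc (dim K)) \<noteq> {}"
  obtains f s where "(f, s) \<in> calibrated_pairs K" "eigenpair \<Gamma> f (energy f)"
    "energy f \<le> var_eigenvalue \<Gamma> (Suc (dim K))"
proof -
  obtain S0 where "S0 \<in> genus_family \<Gamma> (Suc (dim K))" using ne by blast
  then have "calibrated_pairs K \<noteq> {}" using genus_family_meets_calibrated[OF K] by blast
  moreover have "continuous_on (calibrated_pairs K) (\<lambda>p. energy (fst p))"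
    by (rule continuous_on_compose2[OF continuous_on_energy[of UNIV]]) (auto intro: continuous_intros)
  ultimately obtain p where p: "p \<in> calibrated_pairs K"
      "\<And>q. q \<in> calibrated_pairs K \<Longrightarrow> energy (fst p) \<le> energy (fst q)"
    using continuous_attains_inf[OF compact_calibrated_pairs] by metis
  obtain f s where fs: "p = (f, s)" by (cases p)
  have min: "energy f \<le> energy g" if "(g, t) \<in> calibrated_pairs K" for g t
    using p(2)[OF that] fs by simp
  show thesis
  proof (rule that)
    show fsC: "(f, s) \<in> calibrated_pairs K" using p fs by simp
    show "eigenpair \<Gamma> f (energy f)"
      by (rule eigenpair_of_calibrated_gradient[OF fsC minimal_calibrated_pair_gradient[OF K kernel fsC min]])
    show "energy f \<le> var_eigenvalue \<Gamma> (Suc (dim K))"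
    proof (rule var_eigenvalue_ge[OF ne])
      fix S assume "S \<in> genus_family \<Gamma> (Suc (dim K))"
      then obtain g t where "g \<in> S" "(g, t) \<in> calibrated_pairs K"
        by (rule genus_family_meets_calibrated[OF K])
      then show "\<exists>g\<in>S. energy f \<le> energy g" using min by blast
    qed
  qed
qed

section \<open>Cheeger constants and sign vectors\<close>

definition signed_indicator :: "'v set \<Rightarrow> 'v set \<Rightarrow> real ^ 'v" where
  "signed_indicator A B = (\<chi> x. if x \<in> A then 1 else if x \<in> B then - 1 else 0)"

lemma edge_vol_arc_sum:
  "edge_vol \<Gamma> s A B = (\<Sum>x\<in>UNIV. \<Sum>y | adj \<Gamma> x y. w x y * of_bool (x \<in> A \<and> y \<in> B \<and> \<sigma> x y = s))"
proof -
  have "(\<Sum>y | y \<in> B \<and> adj \<Gamma> x y \<and> \<sigma> x y = s. w x y)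
      = (\<Sum>y | adj \<Gamma> x y. w x y * of_bool (y \<in> B \<and> \<sigma> x y = s))" for x
    by (intro sum.mono_neutral_cong_left) auto
  then show ?thesis
    unfolding edge_vol_def by (intro sum.mono_neutral_cong_left) auto
qed

lemma boundary_vol_arc_sum:
  "boundary_vol \<Gamma> A = (\<Sum>x\<in>UNIV. \<Sum>y | adj \<Gamma> x y. w x y * of_bool (x \<in> A \<and> y \<notin> A))"
proof -
  have "(\<Sum>y | y \<notin> A \<and> adj \<Gamma> x y. w x y) = (\<Sum>y | adj \<Gamma> x y. w x y * of_bool (y \<notin> A))" for x
    by (intro sum.mono_neutral_cong_left) auto
  then show ?thesis
    unfolding boundary_vol_def by (intro sum.mono_neutral_cong_left) auto
qed

text \<open>
  The factors 2 match since \<open>edge_vol\<close> counts an edge inside \<open>A\<close> from both ends but an edge from \<open>A\<close> to \<open>B\<close>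
  once.
\<close>

lemma energy_signed_indicator:
  assumes "A \<inter> B = {}"
  shows "energy (signed_indicator A B) =
    2 * edge_vol \<Gamma> 1 A B + edge_vol \<Gamma> (-1) A A + edge_vol \<Gamma> (-1) B B + boundary_vol \<Gamma> (A \<union> B)"
proof -
  let ?\<psi> = "\<lambda>x. signed_indicator A B $ x"
  let ?E = "\<lambda>s A B x y. of_bool (x \<in> A \<and> y \<in> B \<and> \<sigma> x y = s) :: real"
  let ?D = "\<lambda>x y. of_bool (x \<in> A \<union> B \<and> y \<notin> A \<union> B) :: real"
  have E_swap: "edge_vol \<Gamma> 1 A B = (\<Sum>x\<in>UNIV. \<Sum>y | adj \<Gamma> x y. w x y * ?E 1 A B y x)"
    unfolding edge_vol_arc_sum using arc_sum_swap[of "\<lambda>x y. w x y * ?E 1 A B x y"]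
    by (simp add: w_sym \<sigma>_sym)
  have D_swap: "boundary_vol \<Gamma> (A \<union> B) = (\<Sum>x\<in>UNIV. \<Sum>y | adj \<Gamma> x y. w x y * ?D y x)"
    unfolding boundary_vol_arc_sum using arc_sum_swap[of "\<lambda>x y. w x y * ?D x y"]
    by (simp add: w_sym)
  have "2 * energy (signed_indicator A B) = (\<Sum>x\<in>UNIV. \<Sum>y | adj \<Gamma> x y. w x y * \<bar>?\<psi> x - \<sigma> x y * ?\<psi> y\<bar>)"
    by (simp add: energy_def)
  also have "\<dots> = (\<Sum>x\<in>UNIV. \<Sum>y | adj \<Gamma> x y.
      2 * (w x y * ?E 1 A B x y) + 2 * (w x y * ?E 1 A B y x) + 2 * (w x y * ?E (-1) A A x y)
      + 2 * (w x y * ?E (-1) B B x y) + w x y * ?D x y + w x y * ?D y x)"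
  proof (intro sum.cong refl)
    fix x y assume "y \<in> {y. adj \<Gamma> x y}"
    then have "\<sigma> x y = 1 \<or> \<sigma> x y = - 1" using \<sigma>_cases by simp
    moreover have "\<sigma> y x = \<sigma> x y" by (rule \<sigma>_sym)
    ultimately show "w x y * \<bar>?\<psi> x - \<sigma> x y * ?\<psi> y\<bar> =
      2 * (w x y * ?E 1 A B x y) + 2 * (w x y * ?E 1 A B y x) + 2 * (w x y * ?E (-1) A A x y)
      + 2 * (w x y * ?E (-1) B B x y) + w x y * ?D x y + w x y * ?D y x"
      using assms by (cases "x \<in> A"; cases "x \<in> B"; cases "y \<in> A"; cases "y \<in> B")
        (auto simp: signed_indicator_def)
  qed
  also have "\<dots> = 2 * edge_vol \<Gamma> 1 A B + 2 * edge_vol \<Gamma> 1 A B + 2 * edge_vol \<Gamma> (-1) A A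
      + 2 * edge_vol \<Gamma> (-1) B B + boundary_vol \<Gamma> (A \<union> B) + boundary_vol \<Gamma> (A \<union> B)"
    by (subst (2) E_swap, subst (2) D_swap)
      (simp only: edge_vol_arc_sum boundary_vol_arc_sum sum.distrib sum_distrib_left)
  finally show ?thesis by simp
qed

lemma mass_signed_indicator: "mass (signed_indicator A B) = vertex_vol \<Gamma> (A \<union> B)"
  unfolding mass_def vertex_vol_def
  by (intro sum.mono_neutral_cong_right) (auto simp: signed_indicator_def)

lemma signed_ratio_eq:
  "A \<inter> B = {} \<Longrightarrow> signed_ratio \<Gamma> A B = energy (signed_indicator A B) / mass (signed_indicator A B)"
  by (simp add: signed_ratio_def energy_signed_indicator mass_signed_indicator)

text \<open>
  The set whose minimum is the Cheeger constant. There are infinitely many families \<open>V\<close> but, for positive \<open>k\<close>,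
  only finitely many values.
\<close>

definition signed_maxima :: "nat \<Rightarrow> real set" where
  "signed_maxima k = {MAX i\<in>{1..k}. signed_ratio \<Gamma> (V (2 * i - 1)) (V (2 * i)) | V. admissible k V}"

lemma finite_signed_maxima:
  assumes "k \<ge> 1"
  shows "finite (signed_maxima k)"
proof (rule finite_subset)
  let ?R = "range (\<lambda>(A, B). signed_ratio \<Gamma> A B)"
  show "finite ?R" by simp
  have "(MAX i\<in>{1..k}. signed_ratio \<Gamma> (V (2 * i - 1)) (V (2 * i))) \<in> ?R" for V
  proof -
    have "(MAX i\<in>{1..k}. signed_ratio \<Gamma> (V (2 * i - 1)) (V (2 * i)))
        \<in> (\<lambda>i. signed_ratio \<Gamma> (V (2 * i - 1)) (V (2 * i))) ` {1..k}"
      using assms by (intro Max_in) auto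
    then obtain i where eq: "(MAX i\<in>{1..k}. signed_ratio \<Gamma> (V (2 * i - 1)) (V (2 * i)))
        = signed_ratio \<Gamma> (V (2 * i - 1)) (V (2 * i))" by blast
    show ?thesis
      unfolding eq by (rule image_eqI[where x = "(V (2 * i - 1), V (2 * i))"]) auto
  qed
  then show "signed_maxima k \<subseteq> ?R" unfolding signed_maxima_def by blast
qed

lemma cheeger_le:
  assumes "k \<ge> 1" "admissible k V"
    and "\<And>i. i \<in> {1..k} \<Longrightarrow> signed_ratio \<Gamma> (V (2 * i - 1)) (V (2 * i)) \<le> l"
  shows "cheeger \<Gamma> k \<le> l"
proof -
  have "cheeger \<Gamma> k \<le> (MAX i\<in>{1..k}. signed_ratio \<Gamma> (V (2 * i - 1)) (V (2 * i)))"
    unfolding cheeger_def signed_maxima_def[symmetric]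
    by (rule Min_le[OF finite_signed_maxima[OF assms(1)]]) (use assms(2) in \<open>auto simp: signed_maxima_def\<close>)
  also have "\<dots> \<le> l" using assms by (subst Max_le_iff) auto
  finally show ?thesis .
qed

lemma cheeger_attained:
  assumes "k \<ge> 1" "admissible k (V0 :: nat \<Rightarrow> 'v set)"
  obtains V where "admissible k V"
    "\<And>i. i \<in> {1..k} \<Longrightarrow> signed_ratio \<Gamma> (V (2 * i - 1)) (V (2 * i)) \<le> cheeger \<Gamma> k"
proof -
  have "signed_maxima k \<noteq> {}" using assms(2) by (auto simp: signed_maxima_def)
  then have "cheeger \<Gamma> k \<in> signed_maxima k"
    unfolding cheeger_def signed_maxima_def[symmetric]
    by (rule Min_in[OF finite_signed_maxima[OF assms(1)]])
  then obtain V where V: "admissible k V"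
      "cheeger \<Gamma> k = (MAX i\<in>{1..k}. signed_ratio \<Gamma> (V (2 * i - 1)) (V (2 * i)))"
    unfolding signed_maxima_def by blast
  show thesis
  proof (rule that[OF V(1)])
    show "signed_ratio \<Gamma> (V (2 * i - 1)) (V (2 * i)) \<le> cheeger \<Gamma> k" if "i \<in> {1..k}" for i
      unfolding V(2) using that by (intro Max_ge) auto
  qed
qed

text \<open>
  Any \<open>k\<close> of the vectors, enumerated from 1 to \<open>k\<close>, give an admissible family through their level sets at
  \<open>1\<close> (odd positions) and \<open>-1\<close> (even positions).
\<close>

lemma cheeger_le_of_disjoint_sign_vectors:
  fixes \<psi> :: "'c \<Rightarrow> real ^ 'v"
  assumes C: "finite C" "k \<le> card C" and "k \<ge> 1"
    and vals: "\<And>c x. c \<in> C \<Longrightarrow> \<psi> c $ x \<in> {-1, 0, 1}"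
    and nz: "\<And>c. c \<in> C \<Longrightarrow> \<psi> c \<noteq> 0"
    and disj: "\<And>c d x. c \<in> C \<Longrightarrow> d \<in> C \<Longrightarrow> \<psi> c $ x \<noteq> 0 \<Longrightarrow> \<psi> d $ x \<noteq> 0 \<Longrightarrow> c = d"
    and le: "\<And>c. c \<in> C \<Longrightarrow> energy (\<psi> c) \<le> l * mass (\<psi> c)"
  shows "\<exists>V :: nat \<Rightarrow> 'v set. admissible k V" "cheeger \<Gamma> k \<le> l"
proof -
  obtain D where D: "D \<subseteq> C" "card D = k" "finite D"
    using obtain_subset_with_card_n[OF C(2)] by blast
  then obtain e where e: "bij_betw e {1..k} D"
    using ex_bij_betw_nat_finite_1 by blast
  have eC: "e i \<in> C" if "i \<in> {1..k}" for i using e D(1) that by (auto simp: bij_betw_def)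
  have einj: "i = j" if "e i = e j" "i \<in> {1..k}" "j \<in> {1..k}" for i j
    by (rule inj_onD[OF bij_betw_imp_inj_on[OF e] that])
  define V where "V j = (if odd j then {x. \<psi> (e ((j + 1) div 2)) $ x = 1}
      else {x. \<psi> (e ((j + 1) div 2)) $ x = - 1})" for j
  have V: "V (2 * i - 1) = {x. \<psi> (e i) $ x = 1}" "V (2 * i) = {x. \<psi> (e i) $ x = - 1}" if "i \<in> {1..k}" for i
    using that by (auto simp: V_def)
  have supp: "V (2 * i - 1) \<union> V (2 * i) = {x. \<psi> (e i) $ x \<noteq> 0}" if "i \<in> {1..k}" for i
    unfolding V[OF that] using vals[OF eC[OF that]] by fastforce
  have adm: "admissible k V"
    unfolding admissible_def
  proof (intro conjI ballI impI)
    fix i assume i: "i \<in> {1..k}"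
    show "V (2 * i - 1) \<inter> V (2 * i) = {}" using V[OF i] by auto
    show "V (2 * i - 1) \<union> V (2 * i) \<noteq> {}"
      unfolding supp[OF i] using nz[OF eC[OF i]] by (auto simp: vec_eq_iff)
  next
    fix i j assume ij: "i \<in> {1..k}" "j \<in> {1..k}" "i \<noteq> j"
    show "(V (2 * i - 1) \<union> V (2 * i)) \<inter> (V (2 * j - 1) \<union> V (2 * j)) = {}"
    proof (rule ccontr)
      assume "\<not> ?thesis"
      then obtain x where "\<psi> (e i) $ x \<noteq> 0" "\<psi> (e j) $ x \<noteq> 0"
        unfolding supp[OF ij(1)] supp[OF ij(2)] by blast
      from disj[OF eC[OF ij(1)] eC[OF ij(2)] this] have "i = j" by (rule einj[OF _ ij(1,2)])
      then show False using ij(3) by contradiction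
    qed
  qed
  then show "\<exists>V :: nat \<Rightarrow> 'v set. admissible k V" by blast
  show "cheeger \<Gamma> k \<le> l"
  proof (rule cheeger_le[OF \<open>k \<ge> 1\<close> adm])
    fix i assume i: "i \<in> {1..k}"
    have "signed_indicator (V (2 * i - 1)) (V (2 * i)) = \<psi> (e i)"
      unfolding vec_eq_iff
    proof
      fix x
      show "signed_indicator (V (2 * i - 1)) (V (2 * i)) $ x = \<psi> (e i) $ x"
        unfolding V[OF i] using vals[OF eC[OF i], of x] by (auto simp: signed_indicator_def)
    qed
    moreover have "V (2 * i - 1) \<inter> V (2 * i) = {}" using V[OF i] by auto
    ultimately show "signed_ratio \<Gamma> (V (2 * i - 1)) (V (2 * i)) \<le> l"
      using le[OF eC[OF i]] mass_pos[OF nz[OF eC[OF i]]]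
      by (simp add: signed_ratio_eq pos_divide_le_eq)
  qed
qed

text \<open>
  On the span of the vectors the energy is at most, and the mass is exactly, the combination of the
  individual energies and masses with the absolute values of the coefficients.
\<close>

lemma var_eigenvalue_le_of_disjoint_vectors:
  fixes \<psi> :: "'c \<Rightarrow> real ^ 'v"
  assumes I: "finite I" "I \<noteq> {}"
    and nz: "\<And>i. i \<in> I \<Longrightarrow> \<psi> i \<noteq> 0"
    and disj: "\<And>i j x. i \<in> I \<Longrightarrow> j \<in> I \<Longrightarrow> \<psi> i $ x \<noteq> 0 \<Longrightarrow> \<psi> j $ x \<noteq> 0 \<Longrightarrow> i = j"
    and le: "\<And>i. i \<in> I \<Longrightarrow> energy (\<psi> i) \<le> l * mass (\<psi> i)"
  shows "genus_family \<Gamma> (card I) \<noteq> {}" "var_eigenvalue \<Gamma> (card I) \<le> l"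
proof -
  have inj: "inj_on \<psi> I"
  proof (rule inj_onI)
    fix i j assume ij: "i \<in> I" "j \<in> I" "\<psi> i = \<psi> j"
    obtain x where "\<psi> i $ x \<noteq> 0" using nz[OF ij(1)] by (auto simp: vec_eq_iff)
    then show "i = j" using disj[OF ij(1,2)] ij(3) by metis
  qed
  have reindex: "(\<Sum>v\<in>\<psi> ` I. u v *\<^sub>R v) = (\<Sum>i\<in>I. u (\<psi> i) *\<^sub>R \<psi> i)" for u
    using inj by (simp add: sum.reindex)
  have mass_sum: "mass (\<Sum>i\<in>I. c i *\<^sub>R \<psi> i) = (\<Sum>i\<in>I. \<bar>c i\<bar> * mass (\<psi> i))" for c
    using I(1) disj by (rule mass_sum_disjoint)
  have "independent (\<psi> ` I)"
  proof
    assume "dependent (\<psi> ` I)"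
    then obtain u where u: "\<exists>v\<in>\<psi> ` I. u v \<noteq> 0" "(\<Sum>v\<in>\<psi> ` I. u v *\<^sub>R v) = 0"
      using dependent_finite[of "\<psi> ` I"] I by auto
    have "(\<Sum>i\<in>I. \<bar>u (\<psi> i)\<bar> * mass (\<psi> i)) = 0"
      using mass_sum[of "\<lambda>i. u (\<psi> i)"] u(2) mass_eq_0_iff[of 0] by (simp add: reindex)
    then have "\<bar>u (\<psi> i)\<bar> * mass (\<psi> i) = 0" if "i \<in> I" for i
      using that I(1) mass_nonneg by (subst (asm) sum_nonneg_eq_0_iff) auto
    then have "u (\<psi> i) = 0" if "i \<in> I" for i
      using that mass_pos[OF nz[OF that]] by fastforce
    then show False using u(1) by blast
  qed
  then have "dim (span (\<psi> ` I)) = card I"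
    using inj by (simp add: dim_eq_card_independent card_image)
  then have fam: "span (\<psi> ` I) \<inter> unit_sphere1 \<Gamma> \<in> genus_family \<Gamma> (card I)"
    using subspace_sphere_in_genus_family[of "span (\<psi> ` I)"] by simp
  then show "genus_family \<Gamma> (card I) \<noteq> {}" by blast
  show "var_eigenvalue \<Gamma> (card I) \<le> l"
  proof (rule var_eigenvalue_le[OF fam])
    show "1 \<le> card I" using I by (simp add: Suc_le_eq card_gt_0_iff)
    fix f assume f: "f \<in> span (\<psi> ` I) \<inter> unit_sphere1 \<Gamma>"
    then obtain u where u: "f = (\<Sum>v\<in>\<psi> ` I. u v *\<^sub>R v)"
      using span_finite[of "\<psi> ` I"] I(1) by auto
    have "energy f \<le> (\<Sum>i\<in>I. \<bar>u (\<psi> i)\<bar> * energy (\<psi> i))"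
      unfolding u reindex by (rule energy_sum_le[OF I(1)])
    also have "\<dots> \<le> (\<Sum>i\<in>I. \<bar>u (\<psi> i)\<bar> * (l * mass (\<psi> i)))"
      using le by (intro sum_mono mult_left_mono) auto
    also have "\<dots> = l * (\<Sum>i\<in>I. \<bar>u (\<psi> i)\<bar> * mass (\<psi> i))"
      by (simp add: sum_distrib_left mult.left_commute)
    also have "\<dots> = l * mass f"
      unfolding u reindex mass_sum ..
    finally show "energy f \<le> l" using f by (simp add: unit_sphere1_eq)
  qed
qed

proposition var_eigenvalue_le_cheeger:
  assumes k: "k \<ge> 1" and "admissible k (V0 :: nat \<Rightarrow> 'v set)"
  shows "genus_family \<Gamma> k \<noteq> {}" "var_eigenvalue \<Gamma> k \<le> cheeger \<Gamma> k"
proof -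
  obtain V where V: "admissible k V"
    "\<And>i. i \<in> {1..k} \<Longrightarrow> signed_ratio \<Gamma> (V (2 * i - 1)) (V (2 * i)) \<le> cheeger \<Gamma> k"
    using cheeger_attained[OF assms] by blast
  define \<psi> where "\<psi> i = signed_indicator (V (2 * i - 1)) (V (2 * i))" for i
  have supp: "\<psi> i $ x \<noteq> 0 \<longleftrightarrow> x \<in> V (2 * i - 1) \<union> V (2 * i)" for i x
    by (simp add: \<psi>_def signed_indicator_def)
  have nz: "\<psi> i \<noteq> 0" if "i \<in> {1..k}" for i
  proof -
    have "V (2 * i - 1) \<union> V (2 * i) \<noteq> {}" using V(1) that by (simp add: admissible_def)
    then obtain x where "x \<in> V (2 * i - 1) \<union> V (2 * i)" by blast
    then have "\<psi> i $ x \<noteq> 0" by (simp only: supp)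
    then show ?thesis by auto
  qed
  have disj: "i = j" if "i \<in> {1..k}" "j \<in> {1..k}" "\<psi> i $ x \<noteq> 0" "\<psi> j $ x \<noteq> 0" for i j x
  proof (rule ccontr)
    assume "i \<noteq> j"
    then have "(V (2 * i - 1) \<union> V (2 * i)) \<inter> (V (2 * j - 1) \<union> V (2 * j)) = {}"
      using V(1) that(1,2) by (simp add: admissible_def)
    moreover have "x \<in> V (2 * i - 1) \<union> V (2 * i)" "x \<in> V (2 * j - 1) \<union> V (2 * j)"
      using that(3,4) by (simp_all only: supp)
    ultimately show False by blast
  qed
  have le: "energy (\<psi> i) \<le> cheeger \<Gamma> k * mass (\<psi> i)" if i: "i \<in> {1..k}" for i
  proof -
    have "V (2 * i - 1) \<inter> V (2 * i) = {}" using V(1) i by (simp add: admissible_def)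
    then have "energy (\<psi> i) / mass (\<psi> i) \<le> cheeger \<Gamma> k"
      using V(2)[OF i] by (simp add: signed_ratio_eq \<psi>_def)
    then show ?thesis using mass_pos[OF nz[OF i]] by (simp add: pos_divide_le_eq)
  qed
  have "finite {1..k}" "{1..k} \<noteq> {}" using k by auto
  from var_eigenvalue_le_of_disjoint_vectors[OF this nz disj le]
  show "genus_family \<Gamma> k \<noteq> {}" "var_eigenvalue \<Gamma> k \<le> cheeger \<Gamma> k" by simp_all
qed

section \<open>Nodal domains\<close>

definition nodal_step :: "real ^ 'v \<Rightarrow> 'v \<Rightarrow> 'v \<Rightarrow> bool" where
  "nodal_step f x y \<longleftrightarrow> adj \<Gamma> x y \<and> f $ x * \<sigma> x y * f $ y > 0"

lemma nodal_step_sym: "nodal_step f x y \<Longrightarrow> nodal_step f y x"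
  unfolding nodal_step_def using adj_sym[of x y] \<sigma>_sym[of x y] by (simp add: mult.commute mult.left_commute)

lemma strong_nodal_walk_iff: "strong_nodal_walk \<Gamma> f xs \<longleftrightarrow> xs \<noteq> [] \<and> successively (nodal_step f) xs"
  by (simp add: strong_nodal_walk_def successively_conv_nth nodal_step_def)

lemma equiv_strong_nodal_rel: "equiv {x. f $ x \<noteq> 0} (strong_nodal_rel \<Gamma> f)"
proof (rule equivI)
  show "strong_nodal_rel \<Gamma> f \<subseteq> {x. f $ x \<noteq> 0} \<times> {x. f $ x \<noteq> 0}"
    by (auto simp: strong_nodal_rel_def)
  show "refl_on {x. f $ x \<noteq> 0} (strong_nodal_rel \<Gamma> f)"
    by (auto simp: refl_on_def strong_nodal_rel_def)
  show "sym (strong_nodal_rel \<Gamma> f)"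
  proof (rule symI)
    fix x y assume "(x, y) \<in> strong_nodal_rel \<Gamma> f"
    then consider "x = y" "f $ x \<noteq> 0"
      | xs where "strong_nodal_walk \<Gamma> f xs" "hd xs = x" "last xs = y" "f $ x \<noteq> 0" "f $ y \<noteq> 0"
      unfolding strong_nodal_rel_def by blast
    then show "(y, x) \<in> strong_nodal_rel \<Gamma> f"
    proof cases
      case 2
      have flip: "(\<lambda>x y. nodal_step f y x) = nodal_step f"
        by (intro ext iffI) (erule nodal_step_sym)+
      have "strong_nodal_walk \<Gamma> f (rev xs)"
        using 2(1) unfolding strong_nodal_walk_iff successively_rev flip by simp
      moreover have "hd (rev xs) = y" "last (rev xs) = x"
        using 2 by (auto simp: hd_rev last_rev)
      ultimately show ?thesis using 2 by (auto simp: strong_nodal_rel_def)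
    qed (auto simp: strong_nodal_rel_def)
  qed
  show "trans (strong_nodal_rel \<Gamma> f)"
  proof (rule transI)
    fix x y z assume xy: "(x, y) \<in> strong_nodal_rel \<Gamma> f" and yz: "(y, z) \<in> strong_nodal_rel \<Gamma> f"
    show "(x, z) \<in> strong_nodal_rel \<Gamma> f"
    proof (cases "x = y \<or> y = z")
      case False
      then obtain xs ys where xs: "strong_nodal_walk \<Gamma> f xs" "hd xs = x" "last xs = y"
        and ys: "strong_nodal_walk \<Gamma> f ys" "hd ys = y" "last ys = z"
        using xy yz by (auto simp: strong_nodal_rel_def)
      obtain ys' where ys': "ys = y # ys'"
        using ys by (cases ys) (auto simp: strong_nodal_walk_iff)
      have "strong_nodal_walk \<Gamma> f (xs @ ys')"
        using xs ys unfolding ys'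
        by (cases ys') (auto simp: strong_nodal_walk_iff successively_append_iff)
      moreover have "hd (xs @ ys') = x" "last (xs @ ys') = z"
        using xs ys unfolding ys' by (auto simp: strong_nodal_walk_iff)
      ultimately show ?thesis using xy yz unfolding strong_nodal_rel_def by blast
    qed (use xy yz in auto)
  qed
qed

lemma nodal_step_rel: "nodal_step f x y \<Longrightarrow> (x, y) \<in> strong_nodal_rel \<Gamma> f"
proof -
  assume xy: "nodal_step f x y"
  then have "strong_nodal_walk \<Gamma> f [x, y]" by (simp add: strong_nodal_walk_iff)
  moreover have "f $ x \<noteq> 0" "f $ y \<noteq> 0" using xy by (auto simp: nodal_step_def)
  ultimately show ?thesis unfolding strong_nodal_rel_def by force
qed

text \<open>
  Let \<open>\<psi>\<close> be the sign of \<open>f\<close> on \<open>D\<close>, extended by zero. On every edge the flow \<open>z\<close> of the eigenvalue equation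
  is also a sign of the difference of \<open>\<psi>\<close>: inside \<open>D\<close> this difference vanishes or has the sign of that
  of \<open>f\<close>, and an edge that leaves \<open>D\<close> is no nodal step, so that the difference of \<open>f\<close> has the sign of \<open>f\<close> at its
  end in \<open>D\<close>. Pairing the equation with \<open>\<psi>\<close> thus computes the energy of \<open>\<psi>\<close>.
\<close>

lemma energy_sign_on_nodal_closed_set:
  assumes f: "eigenpair \<Gamma> f l"
    and D: "\<And>x. x \<in> D \<Longrightarrow> f $ x \<noteq> 0"
    and closed: "\<And>x y. x \<in> D \<Longrightarrow> nodal_step f x y \<Longrightarrow> y \<in> D"
  shows "energy (\<chi> x. if x \<in> D then sgn (f $ x) else 0) = l * mass (\<chi> x. if x \<in> D then sgn (f $ x) else 0)"
proof -
  obtain z z' where z: "\<And>x y. adj \<Gamma> x y \<Longrightarrow> z x y \<in> Sgn (f $ x - \<sigma> x y * f $ y)"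
    and anti: "\<And>x y. adj \<Gamma> x y \<Longrightarrow> z x y = - \<sigma> x y * z y x"
    and z': "\<And>x. z' x \<in> Sgn (f $ x)"
    and eq: "\<And>x. (\<Sum>y | adj \<Gamma> x y. w x y * z x y) = l * \<mu> x * z' x"
    using f unfolding eigenpair_def by blast
  define \<psi> :: "real ^ 'v" where "\<psi> = (\<chi> x. if x \<in> D then sgn (f $ x) else 0)"
  have one_sided: "\<bar>\<psi> $ x - \<sigma> x y * \<psi> $ y\<bar> = z x y * (\<psi> $ x - \<sigma> x y * \<psi> $ y)"
    if a: "adj \<Gamma> x y" and x: "x \<in> D" for x y
  proof (cases "nodal_step f x y")
    case True
    then have "y \<in> D" using closed x by blast
    then have "\<psi> $ x - \<sigma> x y * \<psi> $ y = 0"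
      using True x \<sigma>_cases[OF a]
      by (auto simp: \<psi>_def nodal_step_def sgn_if zero_less_mult_iff mult_less_0_iff split: if_splits)
    then show ?thesis by simp
  next
    case False
    then have le: "f $ x * (\<sigma> x y * f $ y) \<le> 0" using a by (simp add: nodal_step_def mult.assoc)
    have \<psi>y: "\<psi> $ y = 0 \<or> \<psi> $ y = sgn (f $ y)" by (simp add: \<psi>_def)
    consider "f $ x > 0" | "f $ x < 0" using D[OF x] by linarith
    then show ?thesis
    proof cases
      case 1
      then have t: "\<sigma> x y * f $ y \<le> 0" using le by (simp add: mult_le_0_iff)
      then have "f $ x - \<sigma> x y * f $ y > 0" using 1 by linarith
      then have "z x y = 1" using z[OF a] by (simp add: Sgn_def)
      moreover have "\<sigma> x y * \<psi> $ y \<le> 0"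
        using t \<psi>y \<sigma>_cases[OF a] by (auto simp: sgn_if)
      moreover have "\<psi> $ x = 1" using 1 x by (simp add: \<psi>_def)
      ultimately show ?thesis by simp
    next
      case 2
      then have t: "\<sigma> x y * f $ y \<ge> 0" using le by (simp add: mult_le_0_iff)
      then have "f $ x - \<sigma> x y * f $ y < 0" using 2 by linarith
      then have "z x y = - 1" using z[OF a] by (simp add: Sgn_def)
      moreover have "\<sigma> x y * \<psi> $ y \<ge> 0"
        using t \<psi>y \<sigma>_cases[OF a] by (auto simp: sgn_if)
      moreover have "\<psi> $ x = - 1" using 2 x by (simp add: \<psi>_def)
      ultimately show ?thesis by simp
    qed
  qed
  have "\<bar>\<psi> $ x - \<sigma> x y * \<psi> $ y\<bar> = z x y * (\<psi> $ x - \<sigma> x y * \<psi> $ y)" if a: "adj \<Gamma> x y" for x y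
  proof -
    consider "x \<in> D" | "y \<in> D" | "x \<notin> D" "y \<notin> D" by blast
    then show ?thesis
    proof cases
      case 1
      then show ?thesis using one_sided a by blast
    next
      case 2
      have swap: "\<psi> $ x - \<sigma> x y * \<psi> $ y = - \<sigma> x y * (\<psi> $ y - \<sigma> y x * \<psi> $ x)"
        using \<sigma>_square[OF a] by (simp add: \<sigma>_sym[of y x] right_diff_distrib mult.assoc[symmetric])
      have "\<bar>\<psi> $ x - \<sigma> x y * \<psi> $ y\<bar> = \<bar>\<psi> $ y - \<sigma> y x * \<psi> $ x\<bar>"
        unfolding swap abs_mult using \<sigma>_cases[OF a] by auto
      also have "\<dots> = z y x * (\<psi> $ y - \<sigma> y x * \<psi> $ x)"
        using one_sided[of y x] a adj_sym[of x y] 2 by simp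
      also have "\<dots> = (\<sigma> x y * \<sigma> x y) * (z y x * (\<psi> $ y - \<sigma> y x * \<psi> $ x))"
        using \<sigma>_square[OF a] by simp
      also have "\<dots> = (- \<sigma> x y * z y x) * (- \<sigma> x y * (\<psi> $ y - \<sigma> y x * \<psi> $ x))"
        by (simp add: ac_simps)
      also have "\<dots> = z x y * (\<psi> $ x - \<sigma> x y * \<psi> $ y)"
        unfolding swap[symmetric] anti[OF a, symmetric] ..
      finally show ?thesis .
    qed (simp add: \<psi>_def)
  qed
  then have "2 * energy \<psi> = (\<Sum>x\<in>UNIV. \<Sum>y | adj \<Gamma> x y. w x y * (z x y * (\<psi> $ x - \<sigma> x y * \<psi> $ y)))"
    unfolding energy_def by simp
  also have "\<dots> = 2 * (\<Sum>x\<in>UNIV. \<psi> $ x * (\<Sum>y | adj \<Gamma> x y. w x y * z x y))"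
    by (rule arc_flow_Green) (rule anti)
  also have "\<dots> = 2 * (\<Sum>x\<in>UNIV. \<psi> $ x * (l * \<mu> x * z' x))"
    by (simp only: eq)
  also have "(\<Sum>x\<in>UNIV. \<psi> $ x * (l * \<mu> x * z' x)) = (\<Sum>x\<in>UNIV. l * (\<mu> x * \<bar>\<psi> $ x\<bar>))"
  proof (intro sum.cong refl)
    fix x
    have "\<psi> $ x * z' x = \<bar>\<psi> $ x\<bar>"
      using z'[of x] D[of x] by (auto simp: \<psi>_def Sgn_def sgn_if split: if_splits)
    then show "\<psi> $ x * (l * \<mu> x * z' x) = l * (\<mu> x * \<bar>\<psi> $ x\<bar>)" by (simp add: ac_simps)
  qed
  also have "(\<Sum>x\<in>UNIV. l * (\<mu> x * \<bar>\<psi> $ x\<bar>)) = l * mass \<psi>"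
    by (simp add: mass_def sum_distrib_left)
  finally have "energy \<psi> = l * mass \<psi>" by simp
  then show ?thesis by (simp only: \<psi>_def)
qed

proposition cheeger_le_eigenvalue:
  assumes f: "eigenpair \<Gamma> f l" and k: "1 \<le> k" "k \<le> strong_nodal_count \<Gamma> f"
  shows "\<exists>V :: nat \<Rightarrow> 'v set. admissible k V" "cheeger \<Gamma> k \<le> l"
proof -
  let ?X = "{x. f $ x \<noteq> 0}" and ?r = "strong_nodal_rel \<Gamma> f"
  define \<psi> :: "'v set \<Rightarrow> real ^ 'v" where "\<psi> D = (\<chi> x. if x \<in> D then sgn (f $ x) else 0)" for D
  note eqv = equiv_strong_nodal_rel[of f]
  have DX: "D \<subseteq> ?X" if "D \<in> ?X // ?r" for D
    using in_quotient_imp_subset[OF eqv that] .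
  have supp: "\<psi> D $ x \<noteq> 0 \<longleftrightarrow> x \<in> D" if "D \<in> ?X // ?r" for D x
    using DX[OF that] by (auto simp: \<psi>_def sgn_eq_0_iff)
  have fin: "finite (?X // ?r)" by simp
  have card: "k \<le> card (?X // ?r)" using k(2) by (simp add: strong_nodal_count_def)
  have vals: "\<psi> D $ x \<in> {-1, 0, 1}" for D x by (simp add: \<psi>_def sgn_if)
  have nz: "\<psi> D \<noteq> 0" if D: "D \<in> ?X // ?r" for D
  proof -
    obtain x where "x \<in> D" using in_quotient_imp_non_empty[OF eqv D] by blast
    then have "\<psi> D $ x \<noteq> 0" by (simp only: supp[OF D])
    then show ?thesis by auto
  qed
  have disj: "D = D'" if "D \<in> ?X // ?r" "D' \<in> ?X // ?r" "\<psi> D $ x \<noteq> 0" "\<psi> D' $ x \<noteq> 0" for D D' x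
    using quotient_disj[OF eqv that(1,2)] supp that by blast
  have le: "energy (\<psi> D) \<le> l * mass (\<psi> D)" if D: "D \<in> ?X // ?r" for D
  proof -
    have "y \<in> D" if "x \<in> D" "nodal_step f x y" for x y
      using in_quotient_imp_closed[OF eqv D that(1) nodal_step_rel[OF that(2)]] .
    then show ?thesis
      unfolding \<psi>_def using DX[OF D] by (subst energy_sign_on_nodal_closed_set[OF f]) auto
  qed
  show "\<exists>V :: nat \<Rightarrow> 'v set. admissible k V"
    by (rule cheeger_le_of_disjoint_sign_vectors(1)[where \<psi> = \<psi>, OF fin card k(1) vals nz disj le]; assumption)
  show "cheeger \<Gamma> k \<le> l"
    by (rule cheeger_le_of_disjoint_sign_vectors(2)[where \<psi> = \<psi>, OF fin card k(1) vals nz disj le]; assumption)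
qed

section \<open>The kernel of the energy\<close>

lemma subspace_energy_kernel: "subspace {f. energy f = 0}"
  unfolding subspace_def
proof (intro conjI ballI allI)
  show "0 \<in> {f. energy f = 0}" by (simp add: energy_eq_0_iff)
  fix f g :: "real ^ 'v" and c :: real
  assume f: "f \<in> {f. energy f = 0}"
  then show "c *\<^sub>R f \<in> {f. energy f = 0}" by (simp add: energy_scaleR)
  assume "g \<in> {f. energy f = 0}"
  then show "f + g \<in> {f. energy f = 0}" using f energy_add_kernel by simp
qed

text \<open>
  Call two vertices related if evaluation at them agrees up to sign on the whole kernel. Each class on which
  the kernel does not vanish carries a sign vector, and this vector lies in the kernel because neighbours are
  related with the sign \<open>\<sigma>\<close>. An element of the kernel is determined by its values at one representative of
  each class, so these vectors span the kernel and there are at least as many classes as its dimension.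
\<close>

proposition cheeger_nonpos_of_kernel_dim:
  assumes k: "1 \<le> k" "k \<le> dim {f :: real ^ 'v. energy f = 0}"
  shows "cheeger \<Gamma> k \<le> 0"
proof -
  let ?K = "{f :: real ^ 'v. energy f = 0}"
  define same where "same x y \<longleftrightarrow> (\<forall>f\<in>?K. f $ y = f $ x)" for x y
  define opp where "opp x y \<longleftrightarrow> (\<forall>f\<in>?K. f $ y = - f $ x)" for x y
  define R where "R x y \<longleftrightarrow> same x y \<or> opp x y" for x y
  define X where "X = {x. \<exists>f\<in>?K. f $ x \<noteq> 0}"
  have R_refl: "R x x" for x by (simp add: R_def same_def)
  have R_sym: "R x y \<Longrightarrow> R y x" for x y unfolding R_def same_def opp_def by auto
  have R_trans: "R x y \<Longrightarrow> R y u \<Longrightarrow> R x u" for x y u unfolding R_def same_def opp_def by auto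
  have not_both: "\<not> (same x y \<and> opp x y)" if "x \<in> X" for x y
    using that unfolding X_def same_def opp_def by force
  define rep where "rep x = (SOME y. R x y)" for x
  have R_rep: "R x (rep x)" for x unfolding rep_def by (rule someI[of "R x" x]) (rule R_refl)
  have rep_cong: "rep x = rep y" if "R x y" for x y
  proof -
    have "R x = R y" using that R_sym R_trans by blast
    then show ?thesis by (simp add: rep_def)
  qed
  define \<psi> :: "'v \<Rightarrow> real ^ 'v" where "\<psi> b = (\<chi> y. if same b y then 1 else if opp b y then - 1 else 0)" for b
  have supp: "\<psi> b $ y \<noteq> 0 \<longleftrightarrow> R b y" for b y by (simp add: \<psi>_def R_def)
  define C where "C = rep ` X"
  have CX: "C \<subseteq> X"
  proof
    fix b assume "b \<in> C"
    then obtain x where x: "x \<in> X" "b = rep x" by (auto simp: C_def)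
    then show "b \<in> X" using R_rep[of x] unfolding X_def R_def same_def opp_def by force
  qed
  have disj: "b = c" if "b \<in> C" "c \<in> C" "\<psi> b $ y \<noteq> 0" "\<psi> c $ y \<noteq> 0" for b c y
  proof -
    have "rep b = b" if "b \<in> C" for b
      using that rep_cong[OF R_rep] by (auto simp: C_def)
    moreover have "R b c" using that(3,4) R_sym R_trans unfolding supp by blast
    ultimately show ?thesis using rep_cong that(1,2) by metis
  qed
  have kernel: "energy (\<psi> b) = 0" if b: "b \<in> X" for b
    unfolding energy_eq_0_iff
  proof (intro allI impI)
    fix x y assume a: "adj \<Gamma> x y"
    have edge: "f $ x = \<sigma> x y * f $ y" if "f \<in> ?K" for f
      using that a by (simp add: energy_eq_0_iff)
    from \<sigma>_cases[OF a] show "\<psi> b $ x = \<sigma> x y * \<psi> b $ y"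
    proof
      assume s: "\<sigma> x y = 1"
      then have "same b x = same b y" "opp b x = opp b y"
        using edge by (simp_all add: same_def opp_def)
      then show ?thesis by (simp add: \<psi>_def s)
    next
      assume s: "\<sigma> x y = - 1"
      then have "same b x = opp b y" "opp b x = same b y"
        using edge by (auto simp: same_def opp_def)
      then show ?thesis using not_both[OF b] by (auto simp: \<psi>_def s)
    qed
  qed
  have nz: "\<psi> b \<noteq> 0" for b
  proof -
    have "\<psi> b $ b \<noteq> 0" unfolding supp by (rule R_refl)
    then show ?thesis by auto
  qed
  have "?K \<subseteq> span (\<psi> ` C)"
  proof
    fix f assume f: "f \<in> ?K"
    have "f = (\<Sum>b\<in>C. f $ b *\<^sub>R \<psi> b)"
      unfolding vec_eq_iff
    proof
      fix y
      show "f $ y = (\<Sum>b\<in>C. f $ b *\<^sub>R \<psi> b) $ y"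
      proof (cases "y \<in> X")
        case True
        let ?b = "rep y"
        have b: "?b \<in> C" using True by (simp add: C_def)
        have R: "R ?b y" using R_rep R_sym by blast
        have "\<psi> c $ y = 0" if "c \<in> C - {?b}" for c
          using disj[of c ?b y] R that b supp by blast
        then have "(\<Sum>b\<in>C. f $ b *\<^sub>R \<psi> b) $ y = f $ ?b * \<psi> ?b $ y"
          using b by (simp add: sum.remove[of C ?b])
        also have "\<dots> = f $ y"
          using R f by (auto simp: \<psi>_def R_def same_def opp_def)
        finally show ?thesis by simp
      next
        case False
        have "\<psi> c $ y = 0" if "c \<in> C" for c
        proof (rule ccontr)
          assume "\<psi> c $ y \<noteq> 0"
          then have "R c y" by (simp add: supp)
          then have "y \<in> X" using that CX unfolding X_def R_def same_def opp_def by force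
          then show False using False by contradiction
        qed
        moreover have "f $ y = 0" using False f by (auto simp: X_def)
        ultimately show ?thesis by simp
      qed
    qed
    also have "\<dots> \<in> span (\<psi> ` C)" by (intro span_sum span_scale span_base) auto
    finally show "f \<in> span (\<psi> ` C)" .
  qed
  then have "dim ?K \<le> card (\<psi> ` C)" by (intro dim_le_card) auto
  also have "\<dots> \<le> card C" by (intro card_image_le) auto
  finally have card: "k \<le> card C" using k by simp
  have vals: "\<psi> b $ x \<in> {-1, 0, 1}" for b x by (simp add: \<psi>_def)
  have le: "energy (\<psi> b) \<le> 0 * mass (\<psi> b)" if "b \<in> C" for b
    using kernel[of b] that CX by auto
  show ?thesis
    by (rule cheeger_le_of_disjoint_sign_vectors(2)[where \<psi> = \<psi>, OF _ card k(1) vals nz disj le]; (assumption | simp))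
qed

end

section \<open>Variational eigenvalues and Cheeger constants\<close>

theorem corollary4p2:
  fixes \<Gamma> :: "'v::finite sgraph" and f :: "real ^ 'v" and l :: real and k :: nat
  assumes "signed_graph \<Gamma>"
    and "eigenpair \<Gamma> f l"
    and "l = var_eigenvalue \<Gamma> 1 \<or>
         (CARD('v) \<ge> 2 \<and> l = var_eigenvalue \<Gamma> 2) \<or>
         smallest_positive_eigenvalue \<Gamma> l"
    and "strong_nodal_count \<Gamma> f = k"
  shows "\<forall>i\<in>{1..k}. var_eigenvalue \<Gamma> i = cheeger \<Gamma> i"
proof
  fix i assume "i \<in> {1..k}"
  then have i: "1 \<le> i" "i \<le> strong_nodal_count \<Gamma> f" using assms(4) by auto
  interpret weighted_signed_graph \<Gamma> by unfold_locales (rule assms(1))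
  obtain V :: "nat \<Rightarrow> 'v set" where V: "admissible i V"
    using cheeger_le_eigenvalue(1)[OF assms(2) i] by blast
  have upper: "cheeger \<Gamma> i \<le> l"
    by (rule cheeger_le_eigenvalue(2)[OF assms(2) i])
  note family = var_eigenvalue_le_cheeger(1)[OF i(1) V]
  note le_cheeger = var_eigenvalue_le_cheeger(2)[OF i(1) V]
  have "cheeger \<Gamma> i \<le> var_eigenvalue \<Gamma> i"
    using assms(3)
  proof (elim disjE conjE)
    assume "l = var_eigenvalue \<Gamma> 1"
    then show ?thesis using upper var_eigenvalue_mono[OF _ i(1) family] by simp
  next
    assume l: "l = var_eigenvalue \<Gamma> 2"
    show ?thesis
    proof (cases "i = 1")
      case False
      then have "l \<le> var_eigenvalue \<Gamma> i"
        unfolding l using i(1) by (intro var_eigenvalue_mono family) auto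
      then show ?thesis using upper by simp
    next
      case True
      obtain g s where gs: "(g, s) \<in> calibrated_pairs {0}" and g: "eigenpair \<Gamma> g (energy g)"
        and le: "energy g \<le> var_eigenvalue \<Gamma> 1"
        using eigenpair_below_genus_family[of "{0}"] family True by (auto simp: energy_eq_0_iff)
      have "1 \<le> strong_nodal_count \<Gamma> g"
      proof -
        have "{x. g $ x \<noteq> 0} \<noteq> {}" using g by (auto simp: eigenpair_def vec_eq_iff)
        then have "{x. g $ x \<noteq> 0} // strong_nodal_rel \<Gamma> g \<noteq> {}" by (auto simp: quotient_def)
        then show ?thesis by (simp add: strong_nodal_count_def Suc_le_eq card_gt_0_iff)
      qed
      from cheeger_le_eigenvalue(2)[OF g _ this] show ?thesis using le True by simp
    qed
  next
    assume l: "smallest_positive_eigenvalue \<Gamma> l"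
    let ?K = "{f :: real ^ 'v. energy f = 0}"
    show ?thesis
    proof (cases "i \<le> dim ?K")
      case True
      then show ?thesis
        using cheeger_nonpos_of_kernel_dim[OF i(1)] var_eigenvalue_nonneg[OF i(1) family] by simp
    next
      case False
      then have "genus_family \<Gamma> i \<subseteq> genus_family \<Gamma> (Suc (dim ?K))"
        by (intro genus_family_antimono) simp
      then have "genus_family \<Gamma> (Suc (dim ?K)) \<noteq> {}" using family by auto
      then obtain g s where gs: "(g, s) \<in> calibrated_pairs ?K" and g: "eigenpair \<Gamma> g (energy g)"
        and le: "energy g \<le> var_eigenvalue \<Gamma> (Suc (dim ?K))"
        using eigenpair_below_genus_family[OF subspace_energy_kernel] by blast
      have "energy g \<noteq> 0"
      proof
        assume "energy g = 0"
        then have "pairing s g = 0" using gs by (simp add: calibrated_pairs_def)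
        then show False using pairing_calibrated[OF gs] by simp
      qed
      then have "energy g > 0" using energy_nonneg[of g] by simp
      then have "l \<le> energy g"
        using l g by (auto simp: smallest_positive_eigenvalue_def eigenvalue_def)
      also note le
      also have "var_eigenvalue \<Gamma> (Suc (dim ?K)) \<le> var_eigenvalue \<Gamma> i"
        using False by (intro var_eigenvalue_mono family) auto
      finally show ?thesis using upper by simp
    qed
  qed
  then show "var_eigenvalue \<Gamma> i = cheeger \<Gamma> i" using le_cheeger by simp
qed

end
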